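(* Let $p$ be a prime, let $K$ be a finite extension of $\mathbb{Q}_p$, and let $N/K$ be a fully (totally) ramified Galois extension with $G=\mathrm{Gal}(N/K)$ elementary abelian of order $[N:K]=p^n$. Let $b_{\max}$ denote the largest lower ramification break of $N/K$. Assume that every upper ramification break of $N/K$ is relatively prime to $p$. Then every $\alpha\in N$ with $v_N(\alpha)\equiv b_{\max}\pmod{[N:K]}$ generates a normal basis of $N$ over $K$, i.e. $\{\sigma\alpha:\sigma\in G\}$ is a $K$-basis of $N$. Moreover, no other residue class has this property: for every integer $v$ with $v\not\equiv b_{\max}\pmod{[N:K]}$ there exists $\rho_v\in N$ with $v_N(\rho_v)=v$ such that $\rho_v$ does not generate a normal basis of $N$ over $K$.
   Context: $v_N$ denotes the valuation on $N$ normalized so that $v_N(\pi_N)=1$ for a prime element $\pi_N$ of $N$. For an integer $i\ge -1$, the $i$th lower ramification group is $G_i=\{\sigma\in G: v_N((\sigma-1)\pi_N)\ge i+1\}$. The lower ramification breaks $b_1<\dots<b_m$ are the integers $b$ with $G_b\supsetneq G_{b+1}$; $b_{\max}=b_m$. With $g_i=|G_i|$, the upper ramification breaks $u_1<\dots<u_m$ are given by $u_1=b_1$ and $u_i=\big(b_1g_{b_1}+(b_2-b_1)g_{b_2}+\dots+(b_i-b_{i-1})g_{b_i}\big)/p^n$ for $i\ge2$. *)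

theory Defs
  imports Complex_Main "HOL-Computational_Algebra.Primes" "HOL-Number_Theory.Cong"
begin

definition padic_abs :: "nat \<Rightarrow> rat \<Rightarrow> real" where
  "padic_abs p x =
     (if x = 0 then 0
      else real p powi
        (int (multiplicity (int p) (snd (quotient_of x)))
         - int (multiplicity (int p) (fst (quotient_of x)))))"

text \<open>
  The field \<open>'q\<close> with absolute value \<open>a\<close> is the field of p-adic numbers, i.e. the completion
  of the rationals with respect to the p-adic absolute value: it is complete, and the rationals
  embed isometrically with dense image. This determines \<open>('q, a)\<close> up to unique isometric
  isomorphism.
\<close>

definition is_padic_field :: "nat \<Rightarrow> ('q::field_char_0 \<Rightarrow> real) \<Rightarrow> bool" where
  "is_padic_field p a \<longleftrightarrow>
     (\<forall>x. a x \<ge> 0) \<and> (\<forall>x. a x = 0 \<longleftrightarrow> x = 0) \<and>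
     (\<forall>x y. a (x * y) = a x * a y) \<and>
     (\<forall>x y. a (x + y) \<le> a x + a y) \<and>
     (\<forall>r. a (of_rat r) = padic_abs p r) \<and>
     (\<forall>x. \<forall>e>0. \<exists>r. a (x - of_rat r) < e) \<and>
     (\<forall>X :: nat \<Rightarrow> 'q.
        (\<forall>e>0. \<exists>M. \<forall>m\<ge>M. \<forall>n\<ge>M. a (X m - X n) < e) \<longrightarrow>
        (\<exists>L. (\<lambda>n. a (X n - L)) \<longlonglongrightarrow> 0))"

text \<open>
  An extension of fields is given by the two fields as types together with an embedding \<open>f\<close>
  of the smaller one into the larger one, which turns the larger field into a vector space.
\<close>

definition field_embedding :: "('k::field \<Rightarrow> 'n::field) \<Rightarrow> bool" where
  "field_embedding f \<longleftrightarrow>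
     f 1 = 1 \<and> (\<forall>x y. f (x + y) = f x + f y) \<and> (\<forall>x y. f (x * y) = f x * f y)"

definition ext_scale :: "('k::field \<Rightarrow> 'n::field) \<Rightarrow> 'k \<Rightarrow> 'n \<Rightarrow> 'n" where
  "ext_scale f c x = f c * x"

lemma vector_space_ext_scale:
  assumes "field_embedding f"
  shows "vector_space (ext_scale f)"
  using assms
  by unfold_locales (auto simp: field_embedding_def ext_scale_def algebra_simps)

definition finite_extension :: "('k::field \<Rightarrow> 'n::field) \<Rightarrow> bool" where
  "finite_extension f \<longleftrightarrow>
     field_embedding f \<and> (\<exists>B. finite B \<and> module.span (ext_scale f) B = UNIV)"

definition ext_degree :: "('k::field \<Rightarrow> 'n::field) \<Rightarrow> nat" where
  "ext_degree f = vector_space.dim (ext_scale f) UNIV"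

definition galois_group :: "('k::field \<Rightarrow> 'n::field) \<Rightarrow> ('n \<Rightarrow> 'n) set" where
  "galois_group f = {\<sigma>. field_embedding \<sigma> \<and> bij \<sigma> \<and> (\<forall>c. \<sigma> (f c) = f c)}"

definition galois_extension :: "('k::field \<Rightarrow> 'n::field) \<Rightarrow> bool" where
  "galois_extension f \<longleftrightarrow>
     finite_extension f \<and> {x. \<forall>\<sigma>\<in>galois_group f. \<sigma> x = x} = range f"

definition elementary_abelian :: "nat \<Rightarrow> ('n \<Rightarrow> 'n) set \<Rightarrow> bool" where
  "elementary_abelian p G \<longleftrightarrow>
     (\<forall>\<sigma>\<in>G. \<forall>\<tau>\<in>G. \<sigma> \<circ> \<tau> = \<tau> \<circ> \<sigma>) \<and> (\<forall>\<sigma>\<in>G. \<sigma> ^^ p = id)"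

definition generates_normal_basis :: "('k::field \<Rightarrow> 'n::field) \<Rightarrow> 'n \<Rightarrow> bool" where
  "generates_normal_basis f \<alpha> \<longleftrightarrow>
     \<not> module.dependent (ext_scale f) ((\<lambda>\<sigma>. \<sigma> \<alpha>) ` galois_group f) \<and>
     module.span (ext_scale f) ((\<lambda>\<sigma>. \<sigma> \<alpha>) ` galois_group f) = UNIV"

text \<open>
  Valuations are integer-valued functions whose value at 0 is irrelevant; the convention that
  the valuation of 0 is infinite is made explicit wherever it matters. The last conjunct says
  that \<open>v\<close> lies above the p-adic valuation: for an embedding \<open>j\<close> of the p-adic numbers with
  absolute value \<open>a\<close>, the restriction of \<open>v\<close> is \<open>e\<close> times the p-adic valuation.
\<close>

definition normalized_valuation ::
  "nat \<Rightarrow> ('q::field \<Rightarrow> real) \<Rightarrow> ('q \<Rightarrow> 'n::field) \<Rightarrow> ('n \<Rightarrow> int) \<Rightarrow> bool" where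
  "normalized_valuation p a j v \<longleftrightarrow>
     (\<forall>x y. x \<noteq> 0 \<longrightarrow> y \<noteq> 0 \<longrightarrow> v (x * y) = v x + v y) \<and>
     (\<forall>x y. x \<noteq> 0 \<longrightarrow> y \<noteq> 0 \<longrightarrow> x + y \<noteq> 0 \<longrightarrow> min (v x) (v y) \<le> v (x + y)) \<and>
     (\<exists>x. x \<noteq> 0 \<and> v x = 1) \<and>
     (\<exists>e>0. \<forall>x. x \<noteq> 0 \<longrightarrow> a x = real p powr (- real_of_int (v (j x)) / e))"

definition prime_element :: "('n::field \<Rightarrow> int) \<Rightarrow> 'n \<Rightarrow> bool" where
  "prime_element v \<pi> \<longleftrightarrow> \<pi> \<noteq> 0 \<and> v \<pi> = 1"

text \<open>
  The ramification index is the index of the value group of the smaller field in that of the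
  larger one, which is \<open>\<int>\<close> for a normalized valuation; in a totally ramified extension it equals
  the degree.
\<close>

definition totally_ramified :: "('k::field \<Rightarrow> 'n::field) \<Rightarrow> ('n \<Rightarrow> int) \<Rightarrow> bool" where
  "totally_ramified f v \<longleftrightarrow> v ` (range f - {0}) = {m. int (ext_degree f) dvd m}"

definition lower_ram_group ::
  "('k::field \<Rightarrow> 'n::field) \<Rightarrow> ('n \<Rightarrow> int) \<Rightarrow> 'n \<Rightarrow> int \<Rightarrow> ('n \<Rightarrow> 'n) set" where
  "lower_ram_group f v \<pi> i =
     {\<sigma> \<in> galois_group f. \<sigma> \<pi> - \<pi> = 0 \<or> v (\<sigma> \<pi> - \<pi>) \<ge> i + 1}"

definition lower_breaks ::
  "('k::field \<Rightarrow> 'n::field) \<Rightarrow> ('n \<Rightarrow> int) \<Rightarrow> 'n \<Rightarrow> int set" where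
  "lower_breaks f v \<pi> =
     {b. b \<ge> -1 \<and> lower_ram_group f v \<pi> (b + 1) \<subset> lower_ram_group f v \<pi> b}"

text \<open>The list of lower breaks in increasing order is indexed from 0 here.\<close>

definition upper_break ::
  "('k::field \<Rightarrow> 'n::field) \<Rightarrow> ('n \<Rightarrow> int) \<Rightarrow> 'n \<Rightarrow> nat \<Rightarrow> rat" where
  "upper_break f v \<pi> i =
     (let b = (\<lambda>j. sorted_list_of_set (lower_breaks f v \<pi>) ! j);
          g = (\<lambda>k. int (card (lower_ram_group f v \<pi> k)))
      in if i = 0 then of_int (b 0)
         else of_int (b 0 * g (b 0) + (\<Sum>j=1..i. (b j - b (j - 1)) * g (b j)))
              / of_nat (ext_degree f))"

definition upper_breaks ::
  "('k::field \<Rightarrow> 'n::field) \<Rightarrow> ('n \<Rightarrow> int) \<Rightarrow> 'n \<Rightarrow> rat set" where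
  "upper_breaks f v \<pi> = upper_break f v \<pi> ` {..<card (lower_breaks f v \<pi>)}"

end

theory Submission
  imports Defs "HOL-Computational_Algebra.Polynomial"
begin

text \<open>
  Let \<open>b(g)\<close> be the break of \<open>g\<close>, so \<open>v(g \<pi> - \<pi>) = b(g) + 1\<close>. An element \<open>\<alpha>\<close> generates a normal
  basis iff its trace to the fixed field \<open>L\<close> of every subgroup \<open>H\<close> of index \<open>p\<close> does so over \<open>K\<close>.
  By Euler's formula \<open>\<pi>\<^sup>d\<^sup>-\<^sup>1\<close> (\<open>d = |H|\<close>) divided by the derivative of the minimal polynomial of \<open>\<pi>\<close>
  over \<open>L\<close> has trace 1, and higher powers have traces of positive valuation; so the trace raises
  the valuation by exactly the sum of \<open>b\<close> over \<open>H - {1}\<close> whenever the result is divisible by \<open>d\<close>.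
  By Herbrand's theorem the break \<open>u\<close> of \<open>L/K\<close> is an upper break of \<open>N/K\<close>, and integrality of the
  upper breaks makes the valuation of the trace of \<open>\<alpha>\<close> in \<open>L\<close> congruent to \<open>u\<close> modulo \<open>p\<close>. As \<open>p\<close> does
  not divide \<open>u\<close>, the differences \<open>(\<sigma> - 1)\<^sup>k\<close> of this trace, \<open>k < p\<close>, have valuations incongruent
  modulo \<open>p\<close>, hence are independent over \<open>K\<close>. In the other residue classes Euler's formula over
  \<open>K\<close> gives elements of trace 0.
\<close>

subsection \<open>Field embeddings\<close>

context
  fixes s :: "'a::field \<Rightarrow> 'b::field"
  assumes emb: "field_embedding s"
begin

lemma emb_add: "s (x + y) = s x + s y"
  and emb_mult: "s (x * y) = s x * s y"
  and emb_one: "s 1 = 1"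
  using emb by (auto simp: field_embedding_def)

lemma emb_zero: "s 0 = 0"
  using emb_add[of 0 0] by (metis add.right_neutral add_left_cancel)

lemma emb_neg: "s (- x) = - s x"
  using emb_add[of x "- x"] emb_zero by (simp add: eq_neg_iff_add_eq_0 add.commute)

lemma emb_diff: "s (x - y) = s x - s y"
  using emb_add[of x "- y"] by (simp add: emb_neg)

lemma emb_sum: "s (\<Sum>i\<in>I. a i) = (\<Sum>i\<in>I. s (a i))"
  by (induction I rule: infinite_finite_induct) (auto simp: emb_add emb_zero)

lemma emb_prod: "s (\<Prod>i\<in>I. a i) = (\<Prod>i\<in>I. s (a i))"
  by (induction I rule: infinite_finite_induct) (auto simp: emb_mult emb_one)

lemma emb_power: "s (x ^ k) = s x ^ k"
  by (induction k) (auto simp: emb_mult emb_one)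

lemma emb_of_nat: "s (of_nat k) = of_nat k"
  by (induction k) (auto simp: emb_add emb_one emb_zero)

lemma emb_eq_0_iff: "s x = 0 \<longleftrightarrow> x = 0"
  using emb_mult[of x "inverse x"] emb_zero by (cases "x = 0") (auto simp: emb_one)

lemma emb_inverse: "s (inverse x) = inverse (s x)"
  using emb_mult[of x "inverse x"] by (cases "x = 0") (auto simp: emb_one emb_zero inverse_unique)

lemma emb_divide: "s (x / y) = s x / s y"
  by (simp add: divide_inverse emb_mult emb_inverse)

lemma emb_powi: "s (x powi k) = s x powi k"
  by (simp add: power_int_def emb_power emb_inverse)

end

subsection \<open>Linear independence of families\<close>

text \<open>Independence is assumed for the indexed family, which also rules out repeated vectors;
  since there are as many vectors as the degree, a dimension count then gives spanning.\<close>

lemma independent_family_basis: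
  fixes f :: "'k::field \<Rightarrow> 'n::field" and w :: "'i \<Rightarrow> 'n"
  assumes ext: "finite_extension f" and I: "finite I" "card I = ext_degree f"
    and indep: "\<And>c. (\<Sum>i\<in>I. f (c i) * w i) = 0 \<Longrightarrow> \<forall>i\<in>I. c i = 0"
  shows "\<not> module.dependent (ext_scale f) (w ` I)"
    and "module.span (ext_scale f) (w ` I) = UNIV"
    and "\<exists>c. x = (\<Sum>i\<in>I. f (c i) * w i)"
proof -
  have emb: "field_embedding f" using ext by (simp add: finite_extension_def)
  interpret vs: vector_space "ext_scale f" by (rule vector_space_ext_scale[OF emb])
  have inj: "inj_on w I"
  proof (rule inj_onI, rule ccontr)
    fix i k assume *: "i \<in> I" "k \<in> I" "w i = w k" "i \<noteq> k"
    define c where "c l = (if l = i then 1 else if l = k then -1 else 0 :: 'k)" for l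
    have "(\<Sum>l\<in>I. f (c l) * w l) = (\<Sum>l\<in>{i,k}. f (c l) * w l)"
      by (rule sum.mono_neutral_right) (use * I in \<open>auto simp: c_def emb_zero[OF emb]\<close>)
    also have "\<dots> = 0" using * by (simp add: c_def emb_neg[OF emb] emb_one[OF emb])
    finally have "c i = 0" using indep * by blast
    then show False by (simp add: c_def)
  qed
  show ind: "vs.independent (w ` I)"
  proof
    assume "vs.dependent (w ` I)"
    then obtain u where u: "\<exists>y\<in>w ` I. u y \<noteq> 0" "(\<Sum>y\<in>w ` I. ext_scale f (u y) y) = 0"
      using vs.dependent_finite[of "w ` I"] I by auto
    have "(\<Sum>i\<in>I. f (u (w i)) * w i) = 0"
      using u(2) by (simp add: sum.reindex[OF inj] ext_scale_def)
    from indep[OF this] u(1) show False by auto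
  qed
  obtain B where B: "finite B" "vs.span B = UNIV" using ext by (auto simp: finite_extension_def)
  obtain B' where B': "B' \<subseteq> B" "vs.independent B'" "B \<subseteq> vs.span B'"
    using vs.maximal_independent_subset[of B] by blast
  have "vs.span B' = UNIV"
    using B'(3) B(2) vs.span_mono vs.span_span by (metis top.extremum_uniqueI)
  then interpret fd: finite_dimensional_vector_space "ext_scale f" B'
    by unfold_locales (use B' B in \<open>auto intro: finite_subset\<close>)
  have "card (w ` I) = vs.dim UNIV"
    using I by (simp add: card_image[OF inj] ext_degree_def)
  then show sp: "vs.span (w ` I) = UNIV"
    using fd.card_ge_dim_independent[of "w ` I" UNIV] ind by auto
  have "x \<in> vs.span (w ` I)" by (simp add: sp)
  then obtain u where "x = (\<Sum>y\<in>w ` I. ext_scale f (u y) y)"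
    using vs.span_finite[of "w ` I"] I by auto
  then have "x = (\<Sum>i\<in>I. f (u (w i)) * w i)"
    by (simp add: sum.reindex[OF inj] ext_scale_def)
  then show "\<exists>c. x = (\<Sum>i\<in>I. f (c i) * w i)" by (rule exI[of _ "\<lambda>i. u (w i)"])
qed

subsection \<open>Integer-valued valuations\<close>

locale valuation =
  fixes v :: "'n::field \<Rightarrow> int"
  assumes v_mult: "\<And>x y. x \<noteq> 0 \<Longrightarrow> y \<noteq> 0 \<Longrightarrow> v (x * y) = v x + v y"
    and v_add: "\<And>x y. x \<noteq> 0 \<Longrightarrow> y \<noteq> 0 \<Longrightarrow> x + y \<noteq> 0 \<Longrightarrow> min (v x) (v y) \<le> v (x + y)"
begin

text \<open>Encodes the convention that the valuation of 0 is infinite.\<close>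

definition vge :: "int \<Rightarrow> 'n \<Rightarrow> bool" where
  "vge m x \<longleftrightarrow> x = 0 \<or> m \<le> v x"

lemma v_one [simp]: "v 1 = 0"
  using v_mult[of 1 1] by simp

lemma v_neg [simp]: "v (- x) = v x"
proof (cases "x = 0")
  case False
  have "v (-1) + v (-1) = 0" using v_mult[of "-1" "-1"] by simp
  then show ?thesis using v_mult[of "-1" x] False by simp
qed simp

lemma v_minus_commute: "v (x - y) = v (y - x)"
  using v_neg[of "x - y"] by simp

lemma v_inverse: "x \<noteq> 0 \<Longrightarrow> v (inverse x) = - v x"
  using v_mult[of x "inverse x"] by simp

lemma v_divide: "x \<noteq> 0 \<Longrightarrow> y \<noteq> 0 \<Longrightarrow> v (x / y) = v x - v y"
  by (simp add: divide_inverse v_mult v_inverse)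

lemma v_power: "x \<noteq> 0 \<Longrightarrow> v (x ^ k) = int k * v x"
  by (induction k) (auto simp: v_mult algebra_simps)

lemma v_powi: "x \<noteq> 0 \<Longrightarrow> v (x powi k) = k * v x"
  by (auto simp: power_int_def v_power v_inverse)

lemma v_prod: "(\<And>i. i \<in> I \<Longrightarrow> a i \<noteq> 0) \<Longrightarrow> v (\<Prod>i\<in>I. a i) = (\<Sum>i\<in>I. v (a i))"
  by (induction I rule: infinite_finite_induct) (auto simp: v_mult)

lemma vge_zero [simp]: "vge m 0"
  by (simp add: vge_def)

lemma vge_one [simp]: "vge 0 1"
  by (simp add: vge_def)

lemma vge_mono: "vge m x \<Longrightarrow> k \<le> m \<Longrightarrow> vge k x"
  by (auto simp: vge_def)

lemma vge_neg [simp]: "vge m (- x) \<longleftrightarrow> vge m x"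
  by (simp add: vge_def)

lemma vge_add: "vge m x \<Longrightarrow> vge m y \<Longrightarrow> vge m (x + y)"
  unfolding vge_def using v_add[of x y] by (cases "x = 0"; cases "y = 0"; force)

lemma vge_diff: "vge m x \<Longrightarrow> vge m y \<Longrightarrow> vge m (x - y)"
  using vge_add[of m x "- y"] by simp

lemma vge_mult: "vge m x \<Longrightarrow> vge k y \<Longrightarrow> vge (m + k) (x * y)"
  unfolding vge_def using v_mult[of x y] by (cases "x = 0"; cases "y = 0"; force)

lemma vge_sum: "(\<And>i. i \<in> I \<Longrightarrow> vge m (a i)) \<Longrightarrow> vge m (\<Sum>i\<in>I. a i)"
  by (induction I rule: infinite_finite_induct) (auto intro: vge_add)

lemma vge_of_nat: "vge 0 (of_nat k)"
  by (induction k) (auto intro: vge_add)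

lemma v_add_eq:
  assumes "x \<noteq> 0" "vge (v x + 1) y"
  shows "x + y \<noteq> 0" "v (x + y) = v x"
proof -
  show nz: "x + y \<noteq> 0"
    using assms by (auto simp: vge_def add_eq_0_iff)
  show "v (x + y) = v x"
  proof (cases "y = 0")
    case False
    then have "v y > v x" using assms by (auto simp: vge_def)
    \<comment> \<open>The ultrametric inequality for \<open>x = (x + y) + (- y)\<close> excludes
      \<open>v (x + y) > v x\<close>.\<close>
    then show ?thesis
      using v_add[of x y] v_add[of "x + y" "- y"] nz False assms(1) by auto
  qed simp
qed

text \<open>The unique term of least valuation dominates. The last conclusion records the gap to the
  other terms, so that later arguments can follow the leading term through an automorphism.\<close>

lemma v_sum_distinct:
  assumes "finite I" "i\<^sub>0 \<in> I" "a i\<^sub>0 \<noteq> 0"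
    and dist: "\<And>i k. i \<in> I \<Longrightarrow> k \<in> I \<Longrightarrow> a i \<noteq> 0 \<Longrightarrow> a k \<noteq> 0 \<Longrightarrow> v (a i) = v (a k) \<Longrightarrow> i = k"
  obtains l where "l \<in> I" "a l \<noteq> 0" "(\<Sum>i\<in>I. a i) \<noteq> 0" "v (\<Sum>i\<in>I. a i) = v (a l)"
    "\<And>i. i \<in> I \<Longrightarrow> i \<noteq> l \<Longrightarrow> vge (v (a l) + 1) (a i)"
proof -
  let ?J = "{i\<in>I. a i \<noteq> 0}"
  have J: "finite ?J" "?J \<noteq> {}" using assms by auto
  have "Min ((v \<circ> a) ` ?J) \<in> (v \<circ> a) ` ?J" using J by (intro Min_in) auto
  then obtain l where l: "l \<in> I" "a l \<noteq> 0" "v (a l) = Min ((v \<circ> a) ` ?J)" by auto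
  have other: "vge (v (a l) + 1) (a i)" if "i \<in> I" "i \<noteq> l" for i
  proof (cases "a i = 0")
    case False
    then have "v (a l) \<le> v (a i)" using that l(3) J by auto
    moreover have "v (a l) \<noteq> v (a i)" using dist[of i l] that l False by auto
    ultimately show ?thesis by (auto simp: vge_def)
  qed simp
  have "(\<Sum>i\<in>I. a i) = a l + (\<Sum>i\<in>I - {l}. a i)"
    using assms(1) l(1) by (simp add: sum.remove)
  moreover have "vge (v (a l) + 1) (\<Sum>i\<in>I - {l}. a i)"
    by (rule vge_sum) (use other in auto)
  ultimately show thesis using that[of l] l other v_add_eq[of "a l"] by auto
qed

end

subsection \<open>Lagrange sums\<close>

text \<open>The sums occurring in Euler's formula for the trace of a power divided by the different.\<close>

definition lagrange_sum :: "'a::field set \<Rightarrow> nat \<Rightarrow> 'a" where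
  "lagrange_sum X m = (\<Sum>x\<in>X. x ^ m / (\<Prod>y\<in>X - {x}. x - y))"

text \<open>As \<open>x ^ Suc m - z * x ^ m = x ^ m * (x - z)\<close>, the factor
  \<open>x - z\<close> cancels from the denominators and the summand at \<open>z\<close> drops
  out.\<close>

lemma lagrange_sum_Suc:
  assumes "finite X" "z \<notin> X"
  shows "lagrange_sum (insert z X) (Suc m) = z * lagrange_sum (insert z X) m + lagrange_sum X m"
proof -
  have "lagrange_sum (insert z X) (Suc m) - z * lagrange_sum (insert z X) m
      = (\<Sum>x\<in>insert z X. x ^ m * (x - z) / (\<Prod>y\<in>insert z X - {x}. x - y))"
    unfolding lagrange_sum_def sum_distrib_left sum_subtractf[symmetric]
    by (intro sum.cong refl) (simp add: algebra_simps diff_divide_distrib)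
  also have "\<dots> = (\<Sum>x\<in>X. x ^ m * (x - z) / (\<Prod>y\<in>insert z X - {x}. x - y))"
    using assms by simp
  also have "\<dots> = lagrange_sum X m"
    unfolding lagrange_sum_def
  proof (intro sum.cong refl)
    fix x assume x: "x \<in> X"
    then have "insert z X - {x} = insert z (X - {x})" using assms by auto
    then have "(\<Prod>y\<in>insert z X - {x}. x - y) = (x - z) * (\<Prod>y\<in>X - {x}. x - y)"
      using assms by simp
    then show "x ^ m * (x - z) / (\<Prod>y\<in>insert z X - {x}. x - y) = x ^ m / (\<Prod>y\<in>X - {x}. x - y)"
      using x assms by auto
  qed
  finally show ?thesis by (simp add: algebra_simps)
qed

text \<open>Two points \<open>z\<close> and \<open>w\<close> are split off by the recursion in both
  orders. Comparison turns \<open>(z - w) * lagrange_sum X 0\<close> into a difference of sums over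
  sets with one point less, which both vanish by induction or, over singletons, both equal
  1.\<close>

lemma lagrange_sum_0:
  assumes "finite X" "card X \<ge> 2"
  shows "lagrange_sum X 0 = 0"
  using assms
proof (induction "card X" arbitrary: X rule: less_induct)
  case less
  then obtain z Y where X: "X = insert z Y" "z \<notin> Y"
    by (metis Suc_1 card_le_Suc_iff)
  then have "card Y \<ge> 1" "finite Y" using less.prems by auto
  then obtain w Z where Y: "Y = insert w Z" "w \<notin> Z"
    by (metis One_nat_def card_le_Suc_iff)
  have fin: "finite Z" using less.prems X Y by simp
  have eq: "insert z (insert w Z) = insert w (insert z Z)" by auto
  have "(z - w) * lagrange_sum X 0 = lagrange_sum (insert z Z) 0 - lagrange_sum (insert w Z) 0"
    using lagrange_sum_Suc[of "insert w Z" z 0] lagrange_sum_Suc[of "insert z Z" w 0] X Y fin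
    by (auto simp: eq algebra_simps)
  also have "\<dots> = 0"
  proof (cases "Z = {}")
    case True
    then show ?thesis by (simp add: lagrange_sum_def)
  next
    case False
    then have "card Z \<ge> 1" using fin by (simp add: Suc_leI card_gt_0_iff)
    then show ?thesis using less.hyps[of "insert z Z"] less.hyps[of "insert w Z"] X Y fin by auto
  qed
  finally show ?case using X Y by auto
qed

lemma lagrange_sum_lt:
  assumes "finite X" "Suc m < card X"
  shows "lagrange_sum X m = 0"
  using assms
proof (induction m arbitrary: X)
  case 0
  then show ?case by (simp add: lagrange_sum_0)
next
  case (Suc m)
  then obtain z Y where X: "X = insert z Y" "z \<notin> Y" "finite Y"
    by (metis card.empty equals0I finite_insert mk_disjoint_insert not_less_zero)
  then show ?case using Suc by (simp add: lagrange_sum_Suc)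
qed

lemma lagrange_sum_eq:
  assumes "finite X" "Suc m = card X"
  shows "lagrange_sum X m = 1"
  using assms
proof (induction m arbitrary: X)
  case 0
  then obtain z where "X = {z}" by (metis One_nat_def card_1_singletonE)
  then show ?case by (simp add: lagrange_sum_def)
next
  case (Suc m)
  then obtain z Y where X: "X = insert z Y" "z \<notin> Y" "finite Y"
    by (metis card_Suc_eq finite_insert)
  then have "lagrange_sum Y m = 1" "Suc m < card X" using Suc by auto
  then show ?case using X by (simp add: lagrange_sum_Suc lagrange_sum_lt)
qed

context valuation
begin

text \<open>The sum is the complete homogeneous symmetric polynomial in \<open>X\<close> of positive
  degree \<open>m + 1 - card X\<close>; the recursion gives the bound without that
  identification.\<close>

lemma vge_lagrange_sum:
  assumes "finite X" "card X \<le> m" "\<And>x. x \<in> X \<Longrightarrow> vge 1 x"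
  shows "vge 1 (lagrange_sum X m)"
  using assms
proof (induction m arbitrary: X)
  case 0
  then show ?case by (simp add: lagrange_sum_def)
next
  case (Suc m)
  show ?case
  proof (cases "X = {}")
    case True
    then show ?thesis by (simp add: lagrange_sum_def)
  next
    case False
    then obtain z Y where X: "X = insert z Y" "z \<notin> Y" "finite Y"
      using Suc.prems(1) by (metis ex_in_conv finite_insert mk_disjoint_insert)
    have "vge 0 (lagrange_sum X m)"
    proof (cases "card X \<le> m")
      case True
      then show ?thesis using Suc.IH[of X] Suc.prems vge_mono[of 1 _ 0] by auto
    next
      case False
      then show ?thesis using lagrange_sum_eq[of X m] Suc.prems by auto
    qed
    then have "vge 1 (z * lagrange_sum X m)"
      using vge_mult[of 1 z 0] Suc.prems X by auto
    moreover have "vge 1 (lagrange_sum Y m)"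
      using Suc.IH[of Y] Suc.prems X by auto
    ultimately show ?thesis using X by (simp add: lagrange_sum_Suc vge_add)
  qed
qed

end

subsection \<open>Totally ramified extensions\<close>

locale totally_ramified_extension = valuation v
  for v :: "'n::field_char_0 \<Rightarrow> int" +
  fixes f :: "'k::field_char_0 \<Rightarrow> 'n" and \<pi> :: 'n and q :: nat
  assumes ext: "finite_extension f"
    and degree: "ext_degree f = q"
    and q_pos: "q > 0"
    and pi_nonzero: "\<pi> \<noteq> 0" and v_pi: "v \<pi> = 1"
    and v_base: "v ` (range f - {0}) = {m. int q dvd m}"
begin

lemma emb_f: "field_embedding f"
  using ext by (simp add: finite_extension_def)

lemmas f_hom = emb_add[OF emb_f] emb_mult[OF emb_f] emb_one[OF emb_f] emb_zero[OF emb_f]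
  emb_neg[OF emb_f] emb_diff[OF emb_f] emb_sum[OF emb_f] emb_of_nat[OF emb_f]
  emb_eq_0_iff[OF emb_f]

lemma dvd_v_base: "c \<noteq> 0 \<Longrightarrow> int q dvd v (f c)"
  using v_base f_hom(9)[of c] by blast

lemma v_base_surj:
  assumes "int q dvd m"
  obtains c where "c \<noteq> 0" "v (f c) = m"
proof -
  have "m \<in> v ` (range f - {0})" using assms v_base by simp
  then obtain c where "m = v (f c)" "f c \<noteq> 0" by auto
  then show thesis using that[of c] by (auto simp: f_hom)
qed

text \<open>Nonzero base elements have valuations divisible by \<open>q\<close>, so a nonzero term
  \<open>f (c i) * w i\<close> has valuation congruent to \<open>i\<close> modulo
  \<open>q\<close>.\<close>

lemma base_terms_distinct:
  assumes w: "\<And>i. i < q \<Longrightarrow> w i \<noteq> 0 \<and> v (w i) = int i"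
    and "i < q" "k < q" "f (c i) * w i \<noteq> 0" "f (c k) * w k \<noteq> 0"
    and eq: "v (f (c i) * w i) = v (f (c k) * w k)"
  shows "i = k"
proof -
  have "v (f (c i)) + int i = v (f (c k)) + int k"
    using assms w[of i] w[of k] by (simp add: v_mult)
  then have "int i - int k = v (f (c k)) - v (f (c i))" by simp
  moreover have "int q dvd v (f (c k)) - v (f (c i))"
    using assms by (intro dvd_diff dvd_v_base) (auto simp: f_hom)
  ultimately have "int q dvd int i - int k" by simp
  then have "int i mod int q = int k mod int q" by (simp add: mod_eq_dvd_iff)
  then show ?thesis using assms by simp
qed

lemma expansion_valuation:
  assumes w: "\<And>i. i < q \<Longrightarrow> w i \<noteq> 0 \<and> v (w i) = int i"
    and "k < q" "c k \<noteq> 0"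
  obtains l where "l < q" "c l \<noteq> 0" "(\<Sum>i<q. f (c i) * w i) \<noteq> 0"
    "v (\<Sum>i<q. f (c i) * w i) = v (f (c l)) + int l"
    "\<And>i. i < q \<Longrightarrow> i \<noteq> l \<Longrightarrow> vge (v (f (c l)) + int l + 1) (f (c i) * w i)"
proof -
  have nz: "f (c k) * w k \<noteq> 0" using w[of k] assms by (simp add: f_hom)
  obtain l where "l \<in> {..<q}" "f (c l) * w l \<noteq> 0" "(\<Sum>i<q. f (c i) * w i) \<noteq> 0"
    "v (\<Sum>i<q. f (c i) * w i) = v (f (c l) * w l)"
    "\<And>i. i \<in> {..<q} \<Longrightarrow> i \<noteq> l \<Longrightarrow> vge (v (f (c l) * w l) + 1) (f (c i) * w i)"
    by (rule v_sum_distinct[of "{..<q}" k "\<lambda>i. f (c i) * w i"])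
      (use assms(2) nz base_terms_distinct[of w _ _ c, OF w] in auto)
  then show thesis using that[of l] w[of l] by (auto simp: v_mult f_hom)
qed

text \<open>Elements of valuations 0 to \<open>q - 1\<close> are independent over the base by
  \<open>expansion_valuation\<close>, hence a basis by their number.\<close>

lemma expansion_ex:
  assumes w: "\<And>i. i < q \<Longrightarrow> w i \<noteq> 0 \<and> v (w i) = int i"
  shows "\<exists>c. x = (\<Sum>i<q. f (c i) * w i)"
proof (rule independent_family_basis(3)[OF ext])
  fix c assume 0: "(\<Sum>i<q. f (c i) * w i) = 0"
  show "\<forall>i\<in>{..<q}. c i = 0"
  proof (rule ccontr)
    assume "\<not> (\<forall>i\<in>{..<q}. c i = 0)"
    then obtain k where "k < q" "c k \<noteq> 0" by auto
    from expansion_valuation[of w k c, OF w this] show False using 0 by blast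
  qed
qed (simp_all add: degree)

lemma expansion:
  assumes w: "\<And>i. i < q \<Longrightarrow> w i \<noteq> 0 \<and> v (w i) = int i" and x: "x \<noteq> 0"
  obtains c l where "x = (\<Sum>i<q. f (c i) * w i)" "l < q" "c l \<noteq> 0" "v x = v (f (c l)) + int l"
    "\<forall>i<q. i \<noteq> l \<longrightarrow> vge (v x + 1) (f (c i) * w i)"
proof -
  obtain c where c: "x = (\<Sum>i<q. f (c i) * w i)" using expansion_ex[of w x, OF w] by blast
  have "\<exists>k<q. c k \<noteq> 0"
  proof (rule ccontr)
    assume "\<not> ?thesis"
    then have "x = 0" unfolding c by (simp add: f_hom)
    then show False using x by simp
  qed
  then obtain k where k: "k < q" "c k \<noteq> 0" by blast
  obtain l where l: "l < q" "c l \<noteq> 0" "v x = v (f (c l)) + int l"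
    "\<And>i. i < q \<Longrightarrow> i \<noteq> l \<Longrightarrow> vge (v (f (c l)) + int l + 1) (f (c i) * w i)"
    using expansion_valuation[of w k c, OF w k] unfolding c[symmetric] by blast
  show thesis by (rule that[OF c l(1-3)]) (use l in auto)
qed

lemma pi_powers: "i < q \<Longrightarrow> \<pi> ^ i \<noteq> 0 \<and> v (\<pi> ^ i) = int i"
  by (simp add: pi_nonzero v_power v_pi)

text \<open>
  The prime element satisfies an Eisenstein equation over the base field, which forces its
  conjugates to be prime elements too; so the valuation is Galois invariant even without
  completeness.
\<close>

lemma v_conjugate_pi:
  assumes s: "field_embedding s" "\<And>c. s (f c) = f c"
  shows "v (s \<pi>) = 1"
proof -
  have spi: "s \<pi> \<noteq> 0" using pi_nonzero by (simp add: emb_eq_0_iff[OF s(1)])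
  have nz: "\<pi> ^ q \<noteq> 0" by (simp add: pi_nonzero)
  obtain c l where c: "\<pi> ^ q = (\<Sum>i<q. f (c i) * \<pi> ^ i)" "l < q" "c l \<noteq> 0"
     "v (\<pi> ^ q) = v (f (c l)) + int l"
     "\<forall>i<q. i \<noteq> l \<longrightarrow> vge (v (\<pi> ^ q) + 1) (f (c i) * \<pi> ^ i)"
    using expansion[of "\<lambda>i. \<pi> ^ i" "\<pi> ^ q", OF pi_powers nz] by blast
  have vq: "v (\<pi> ^ q) = int q" by (simp add: pi_nonzero v_power v_pi)
  \<comment> \<open>Both \<open>v (\<pi> ^ q)\<close> and \<open>v (f (c l))\<close> are multiples
    of \<open>q\<close>, so the leading term is the constant one. The other coefficients turn out to
    have valuation at least \<open>q\<close>, which makes the equation Eisenstein.\<close>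
  have "int q dvd int l" using dvd_v_base[OF c(3)] c(4) vq by (metis dvd_add_right_iff dvd_refl)
  then have l0: "l = 0" using c(2) by (metis int_dvd_int_iff nat_dvd_not_less neq0_conv)
  then have vc0: "v (f (c 0)) = int q" and c0: "c 0 \<noteq> 0" using c vq by auto
  have vci: "vge (int q) (f (c i))" if "i < q" "i \<noteq> 0" for i
  proof (cases "c i = 0")
    case False
    have "vge (int q + 1) (f (c i) * \<pi> ^ i)" using c(5) that l0 vq by auto
    then have "int q + 1 \<le> v (f (c i)) + int i"
      using False by (simp add: vge_def f_hom v_mult v_power v_pi pi_nonzero)
    then have "v (f (c i)) > 0" using that by simp
    then have "v (f (c i)) \<ge> int q" using dvd_v_base[OF False] by (simp add: zdvd_imp_le)
    then show ?thesis by (simp add: vge_def)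
  qed (simp add: f_hom)
  have eq: "s \<pi> ^ q = (\<Sum>i<q. f (c i) * s \<pi> ^ i)"
    using arg_cong[OF c(1), of s]
    by (simp add: emb_sum[OF s(1)] emb_mult[OF s(1)] emb_power[OF s(1)] s(2))
  \<comment> \<open>If \<open>v (s \<pi>) \<le> 0\<close>, every term on the right of
    \<open>eq\<close> would have larger valuation than the left side.\<close>
  have pos: "v (s \<pi>) > 0"
  proof (rule ccontr)
    assume neg: "\<not> v (s \<pi>) > 0"
    have "vge (int q * v (s \<pi>) + 1) (f (c i) * s \<pi> ^ i)" if i: "i < q" for i
    proof -
      have "vge (int q) (f (c i))" using vci vc0 i by (cases "i = 0") (auto simp: vge_def)
      moreover have "vge (int i * v (s \<pi>)) (s \<pi> ^ i)" by (simp add: vge_def v_power spi)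
      ultimately have "vge (int q + int i * v (s \<pi>)) (f (c i) * s \<pi> ^ i)" by (rule vge_mult)
      moreover have "int i * v (s \<pi>) \<ge> int q * v (s \<pi>)"
        using neg i by (intro mult_right_mono_neg) auto
      ultimately show ?thesis using q_pos by (auto elim: vge_mono)
    qed
    then have "vge (int q * v (s \<pi>) + 1) (s \<pi> ^ q)" unfolding eq by (intro vge_sum) auto
    then show False by (simp add: vge_def v_power spi)
  qed
  have "vge (int q + 1) (\<Sum>i\<in>{..<q} - {0}. f (c i) * s \<pi> ^ i)"
  proof (rule vge_sum)
    fix i assume i: "i \<in> {..<q} - {0}"
    have "vge 1 (s \<pi> ^ i)"
      using i pos by (auto simp: vge_def v_power spi intro: order.trans[of 1 "1 * v (s \<pi>)"] mult_right_mono)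
    then show "vge (int q + 1) (f (c i) * s \<pi> ^ i)" using vci i by (intro vge_mult) auto
  qed
  moreover have "s \<pi> ^ q = f (c 0) + (\<Sum>i\<in>{..<q} - {0}. f (c i) * s \<pi> ^ i)"
    unfolding eq using q_pos by (subst sum.remove[of _ 0]) auto
  ultimately have "v (s \<pi> ^ q) = int q"
    using v_add_eq(2)[of "f (c 0)"] vc0 c0 by (simp add: f_hom)
  then show ?thesis using q_pos spi by (simp add: v_power)
qed

text \<open>Applying \<open>s\<close> to the expansion of \<open>x\<close> replaces
  \<open>\<pi>\<close> by \<open>s \<pi>\<close>, which has the same valuation; so every term keeps
  its valuation and the leading term stays in the lead.\<close>

lemma v_conjugate:
  assumes s: "field_embedding s" "\<And>c. s (f c) = f c"
  shows "v (s x) = v x"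
proof (cases "x = 0")
  case True
  then show ?thesis by (simp add: emb_zero[OF s(1)])
next
  case False
  obtain c l where c: "x = (\<Sum>i<q. f (c i) * \<pi> ^ i)" "l < q" "c l \<noteq> 0"
     "v x = v (f (c l)) + int l"
     "\<forall>i<q. i \<noteq> l \<longrightarrow> vge (v x + 1) (f (c i) * \<pi> ^ i)"
    using expansion[of "\<lambda>i. \<pi> ^ i" x, OF pi_powers False] by blast
  have spi: "s \<pi> \<noteq> 0" using pi_nonzero by (simp add: emb_eq_0_iff[OF s(1)])
  have vi: "v (f (c i) * s \<pi> ^ i) = v (f (c i) * \<pi> ^ i)" for i
    using v_conjugate_pi[OF s] by (cases "c i = 0") (auto simp: f_hom v_mult v_power spi pi_nonzero v_pi)
  have "s x = (\<Sum>i<q. f (c i) * s \<pi> ^ i)"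
    by (subst c(1)) (simp add: emb_sum[OF s(1)] emb_mult[OF s(1)] emb_power[OF s(1)] s(2))
  also have "\<dots> = f (c l) * s \<pi> ^ l + (\<Sum>i\<in>{..<q} - {l}. f (c i) * s \<pi> ^ i)"
    using c(2) by (subst sum.remove[of _ l]) auto
  finally have sx: "s x = \<dots>" .
  have "vge (v x + 1) (\<Sum>i\<in>{..<q} - {l}. f (c i) * s \<pi> ^ i)"
    by (rule vge_sum) (use c(5) vi in \<open>auto simp: vge_def pi_nonzero spi\<close>)
  moreover have "v (f (c l) * s \<pi> ^ l) = v x" "f (c l) * s \<pi> ^ l \<noteq> 0"
    unfolding vi using c(3,4) by (auto simp: v_mult v_power f_hom pi_nonzero v_pi spi)
  ultimately show ?thesis unfolding sx using v_add_eq(2) by metis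
qed

end

subsection \<open>Elementary abelian Galois groups\<close>

locale elementary_abelian_extension = totally_ramified_extension v f \<pi> q
  for v :: "'n::field_char_0 \<Rightarrow> int" and f :: "'k::field_char_0 \<Rightarrow> 'n" and \<pi> :: 'n and q :: nat +
  fixes p :: nat
  assumes p_prime: "prime p"
    and v_p: "v (of_nat p) > 0"
    and galois: "galois_extension f"
    and card_G: "card (galois_group f) = q"
    and elem: "elementary_abelian p (galois_group f)"
begin

abbreviation G :: "('n \<Rightarrow> 'n) set" where
  "G \<equiv> galois_group f"

lemma finite_G [simp]: "finite G"
  using card_G q_pos by (intro card_ge_0_finite) simp

lemma G_emb: "s \<in> G \<Longrightarrow> field_embedding s"
  and G_base: "s \<in> G \<Longrightarrow> s (f c) = f c"
  by (auto simp: galois_group_def)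

lemma fixed_G: "(\<And>s. s \<in> G \<Longrightarrow> s x = x) \<Longrightarrow> x \<in> range f"
  using galois by (auto simp: galois_extension_def)

lemma id_G [simp]: "id \<in> G"
  by (auto simp: galois_group_def field_embedding_def)

lemma comp_G: "s \<in> G \<Longrightarrow> t \<in> G \<Longrightarrow> s \<circ> t \<in> G"
  by (auto simp: galois_group_def field_embedding_def intro: bij_comp)

lemma comm_G: "s \<in> G \<Longrightarrow> t \<in> G \<Longrightarrow> s \<circ> t = t \<circ> s"
  and funpow_p: "s \<in> G \<Longrightarrow> s ^^ p = id"
  using elem by (auto simp: elementary_abelian_def)

lemma comm_G': "s \<in> G \<Longrightarrow> t \<in> G \<Longrightarrow> s (t x) = t (s x)"
  using comm_G by (metis comp_apply)

lemma funpow_G: "s \<in> G \<Longrightarrow> s ^^ k \<in> G"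
  by (induction k) (auto simp: comp_G)

lemma funpow_mod_p: "s \<in> G \<Longrightarrow> s ^^ (k mod p) = s ^^ k"
proof -
  assume s: "s \<in> G"
  have "s ^^ k = s ^^ (p * (k div p) + k mod p)" by simp
  also have "\<dots> = (s ^^ p) ^^ (k div p) \<circ> s ^^ (k mod p)"
    by (simp only: funpow_add funpow_mult)
  also have "\<dots> = s ^^ (k mod p)" using funpow_p[OF s] by simp
  finally show ?thesis by simp
qed

lemma p_gt_1: "p > 1"
  using p_prime prime_gt_1_nat by blast

lemma v_G: "s \<in> G \<Longrightarrow> v (s x) = v x"
  by (intro v_conjugate G_emb) (auto simp: G_base)

lemma vge_G: "s \<in> G \<Longrightarrow> vge m (s x) \<longleftrightarrow> vge m x"
  by (simp add: vge_def v_G emb_eq_0_iff[OF G_emb])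

text \<open>The powers of \<open>\<pi>\<close> span the extension, so an automorphism is determined
  by its value at \<open>\<pi>\<close>.\<close>

lemma G_pi_eq:
  assumes s: "s \<in> G" "s \<pi> = \<pi>"
  shows "s = id"
proof
  fix x
  obtain c where "x = (\<Sum>i<q. f (c i) * \<pi> ^ i)"
    using expansion_ex[of "\<lambda>i. \<pi> ^ i" x, OF pi_powers] by blast
  then show "s x = id x"
    using s G_emb[OF s(1)] by (simp add: emb_sum emb_mult emb_power G_base)
qed

text \<open>Since \<open>s ^^ p = id\<close>, the power \<open>s ^^ (p - 1)\<close> is the inverse
  of \<open>s\<close>. This is why \<open>subgrp\<close> asks only for \<open>id\<close> and closure
  under composition.\<close>

lemma inverse_comp: "s \<in> G \<Longrightarrow> s \<circ> (s ^^ (p - 1) \<circ> t) = t"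
  and inverse_comp': "s \<in> G \<Longrightarrow> s ^^ (p - 1) \<circ> (s \<circ> t) = t"
proof -
  assume s: "s \<in> G"
  have "s \<circ> s ^^ (p - 1) = s ^^ p"
    using p_gt_1 by (metis Suc_diff_1 funpow.simps(2) gr_implies_not0 neq0_conv)
  then have *: "s \<circ> s ^^ (p - 1) = id" by (simp add: funpow_p[OF s])
  then show "s \<circ> (s ^^ (p - 1) \<circ> t) = t" by (simp add: comp_assoc[symmetric])
  show "s ^^ (p - 1) \<circ> (s \<circ> t) = t"
    using * comm_G[OF s funpow_G[OF s]] by (simp add: comp_assoc[symmetric])
qed

lemma inj_pi: "inj_on (\<lambda>s. s \<pi>) G"
proof (rule inj_onI)
  fix s t assume st: "s \<in> G" "t \<in> G" "s \<pi> = t \<pi>"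
  have u: "s ^^ (p - 1) \<circ> t \<in> G" using st by (intro comp_G funpow_G)
  have "(s ^^ (p - 1) \<circ> t) \<pi> = (s ^^ (p - 1) \<circ> (s \<circ> id)) \<pi>" using st by simp
  then have "(s ^^ (p - 1) \<circ> t) \<pi> = \<pi>" unfolding inverse_comp'[OF st(1)] by simp
  then have "s ^^ (p - 1) \<circ> t = id" by (rule G_pi_eq[OF u])
  then show "s = t" using inverse_comp[OF st(1), of t] by simp
qed

text \<open>The lower ramification break of a nontrivial automorphism; meaningless at \<open>id\<close>.\<close>

definition brk :: "('n \<Rightarrow> 'n) \<Rightarrow> int" where
  "brk s = v (s \<pi> - \<pi>) - 1"

lemma brk_nonneg:
  assumes "s \<in> G" "s \<noteq> id"
  shows "brk s \<ge> 0"
proof -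
  have "vge 1 (s \<pi> - \<pi>)" using assms by (intro vge_diff) (auto simp: vge_def v_pi v_G)
  then show ?thesis using G_pi_eq assms by (auto simp: vge_def brk_def)
qed

lemma vge_brk: "s \<in> G \<Longrightarrow> s = id \<or> m \<le> brk s \<longleftrightarrow> vge (m + 1) (s \<pi> - \<pi>)"
  using G_pi_eq by (auto simp: vge_def brk_def)

text \<open>The identity \<open>(s \<circ> t) \<pi> - \<pi> = s (t \<pi> - \<pi>) + (s \<pi> -
  \<pi>)\<close> and the invariance of \<open>v\<close> close the lower ramification groups under
  composition. The disjunct with \<open>id\<close> stands for an infinite break.\<close>

lemma brk_comp:
  assumes "s \<in> G" "t \<in> G" "s = id \<or> m \<le> brk s" "t = id \<or> m \<le> brk t"
  shows "s \<circ> t = id \<or> m \<le> brk (s \<circ> t)"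
proof -
  have "(s \<circ> t) \<pi> - \<pi> = s (t \<pi> - \<pi>) + (s \<pi> - \<pi>)"
    by (simp add: emb_diff[OF G_emb[OF assms(1)]])
  moreover have "vge (m + 1) (s (t \<pi> - \<pi>))" "vge (m + 1) (s \<pi> - \<pi>)"
    using assms vge_brk by (auto simp: vge_G)
  ultimately have "vge (m + 1) ((s \<circ> t) \<pi> - \<pi>)" using vge_add by metis
  then show ?thesis using vge_brk comp_G assms by blast
qed

lemma brk_funpow:
  assumes "s \<in> G" "s = id \<or> m \<le> brk s"
  shows "s ^^ k = id \<or> m \<le> brk (s ^^ k)"
proof (induction k)
  case (Suc k)
  show ?case unfolding funpow.simps by (rule brk_comp[OF assms(1) funpow_G[OF assms(1)] assms(2) Suc])
qed simp

definition subgrp :: "('n \<Rightarrow> 'n) set \<Rightarrow> bool" where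
  "subgrp H \<longleftrightarrow> H \<subseteq> G \<and> id \<in> H \<and> (\<forall>s\<in>H. \<forall>t\<in>H. s \<circ> t \<in> H)"

lemma subgrp_G: "subgrp G"
  by (auto simp: subgrp_def comp_G)

lemma subgrp_funpow: "subgrp H \<Longrightarrow> s \<in> H \<Longrightarrow> s ^^ k \<in> H"
  by (induction k) (auto simp: subgrp_def)

lemma bij_betw_translate:
  assumes "subgrp H" "s \<in> H"
  shows "bij_betw (\<lambda>t. s \<circ> t) H H"
proof (rule bij_betw_byWitness[where f' = "\<lambda>t. s ^^ (p - 1) \<circ> t"])
  have s: "s \<in> G" using assms by (auto simp: subgrp_def)
  show "\<forall>a\<in>H. s ^^ (p - 1) \<circ> (s \<circ> a) = a" "\<forall>a\<in>H. s \<circ> (s ^^ (p - 1) \<circ> a) = a"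
    using inverse_comp[OF s] inverse_comp'[OF s] by auto
  have "s ^^ (p - 1) \<in> H" using assms by (rule subgrp_funpow)
  then show "(\<lambda>t. s \<circ> t) ` H \<subseteq> H" "(\<lambda>t. s ^^ (p - 1) \<circ> t) ` H \<subseteq> H"
    using assms by (auto simp: subgrp_def)
qed

lemma sum_translate:
  assumes "subgrp H" "s \<in> H"
  shows "(\<Sum>t\<in>H. F (s \<circ> t)) = (\<Sum>t\<in>H. F t)"
  using sum.reindex_bij_betw[OF bij_betw_translate[OF assms]] .

lemma prod_translate:
  assumes "subgrp H" "s \<in> H"
  shows "(\<Prod>t\<in>H. F (s \<circ> t)) = (\<Prod>t\<in>H. F t)"
  using prod.reindex_bij_betw[OF bij_betw_translate[OF assms]] .

lemma finite_subgrp: "subgrp H \<Longrightarrow> finite H"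
  using finite_subset[OF _ finite_G] by (auto simp: subgrp_def)

lemma card_subgrp_pos: "subgrp H \<Longrightarrow> card H > 0"
  using finite_subgrp by (auto simp: subgrp_def card_gt_0_iff)

text \<open>The exponent \<open>i\<close> is invertible modulo \<open>p\<close>, so \<open>s\<close>
  is itself a power of \<open>s ^^ i\<close>.\<close>

lemma subgrp_funpow_cancel:
  assumes H: "subgrp H" and s: "s \<in> G" and i: "0 < i" "i < p" and "s ^^ i \<in> H"
  shows "s \<in> H"
proof -
  have "coprime i p" using i p_prime by (metis coprime_commute nat_dvd_not_less prime_imp_coprime)
  then obtain m where "[i * m = 1] (mod p)" using cong_solve_coprime_nat by auto
  then have "(i * m) mod p = 1" using p_gt_1 by (simp add: cong_def)
  then have "s ^^ (i * m) = s" using funpow_mod_p[OF s, of "i * m"] by simp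
  then have "(s ^^ i) ^^ m = s" by (simp add: funpow_mult)
  then show ?thesis using subgrp_funpow[OF H assms(5), of m] by simp
qed

section \<open>Traces, the different and Euler's formula\<close>

definition tr :: "('n \<Rightarrow> 'n) set \<Rightarrow> 'n \<Rightarrow> 'n" where
  "tr H x = (\<Sum>h\<in>H. h x)"

lemma tr_fixed:
  assumes "subgrp H" "s \<in> H"
  shows "s (tr H x) = tr H x"
proof -
  have s: "s \<in> G" using assms by (auto simp: subgrp_def)
  show ?thesis
    using sum_translate[OF assms, of "\<lambda>t. t x"] by (simp add: tr_def emb_sum[OF G_emb[OF s]])
qed

lemma tr_sum: "subgrp H \<Longrightarrow> tr H (\<Sum>i\<in>I. a i) = (\<Sum>i\<in>I. tr H (a i))"
  unfolding tr_def
  by (subst sum.swap) (intro sum.cong refl emb_sum G_emb, auto simp: subgrp_def)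

lemma tr_mult:
  assumes "subgrp H" "\<forall>h\<in>H. h c = c"
  shows "tr H (c * x) = c * tr H x"
proof -
  have "h (c * x) = c * h x" if "h \<in> H" for h
    using assms that emb_mult[OF G_emb, of h c x] by (auto simp: subgrp_def)
  then show ?thesis by (simp add: tr_def sum_distrib_left)
qed

text \<open>The derivative of the minimal polynomial of \<open>\<pi>\<close> over the fixed field of \<open>H\<close>, taken at \<open>\<pi>\<close>.\<close>

definition dif :: "('n \<Rightarrow> 'n) set \<Rightarrow> 'n" where
  "dif H = (\<Prod>h\<in>H - {id}. \<pi> - h \<pi>)"

lemma dif_nonzero: "subgrp H \<Longrightarrow> dif H \<noteq> 0"
  unfolding dif_def using G_pi_eq finite_subgrp by (fastforce simp: subgrp_def)

text \<open>Hilbert's formula for the different: each factor \<open>\<pi> - h \<pi>\<close>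
  contributes \<open>brk h + 1\<close>.\<close>

lemma v_dif:
  assumes "subgrp H"
  shows "v (dif H) = (\<Sum>h\<in>H - {id}. brk h) + int (card H) - 1"
proof -
  have "v (dif H) = (\<Sum>h\<in>H - {id}. v (\<pi> - h \<pi>))"
    unfolding dif_def by (rule v_prod) (use G_pi_eq assms in \<open>fastforce simp: subgrp_def\<close>)
  also have "\<dots> = (\<Sum>h\<in>H - {id}. brk h + 1)"
    by (simp add: brk_def v_minus_commute[of \<pi>])
  also have "\<dots> = (\<Sum>h\<in>H - {id}. brk h) + int (card H) - 1"
    using assms card_subgrp_pos[OF assms] finite_subgrp[OF assms]
    by (simp add: sum.distrib subgrp_def card_Diff_singleton)
  finally show ?thesis .
qed

text \<open>Euler's formula: an element \<open>g\<close> of \<open>H\<close> maps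
  \<open>dif H\<close> to the product of \<open>g \<pi> - h \<pi>\<close> over
  \<open>h \<noteq> g\<close>, which is the denominator of the summand at
  \<open>g \<pi>\<close>.\<close>

lemma tr_pi_power:
  assumes H: "subgrp H"
  shows "tr H (\<pi> ^ m / dif H) = lagrange_sum ((\<lambda>h. h \<pi>) ` H) m"
proof -
  have inj: "inj_on (\<lambda>h. h \<pi>) H" using inj_pi H by (auto simp: subgrp_def intro: inj_on_subset)
  have "g (\<pi> ^ m / dif H) = g \<pi> ^ m / (\<Prod>y\<in>(\<lambda>h. h \<pi>) ` H - {g \<pi>}. g \<pi> - y)" if g: "g \<in> H" for g
  proof -
    have gG: "g \<in> G" using g H by (auto simp: subgrp_def)
    have idH: "id \<in> H" using H by (simp add: subgrp_def)
    have "bij_betw (\<lambda>t. g \<circ> t) (H - {id}) (H - {g})"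
      using bij_betw_DiffI[OF bij_betw_translate[OF H g], of "{id}" "{g}"] idH g by auto
    then have "(\<Prod>h\<in>H - {g}. g \<pi> - h \<pi>) = (\<Prod>h\<in>H - {id}. g \<pi> - (g \<circ> h) \<pi>)"
      by (rule prod.reindex_bij_betw[symmetric])
    also have "\<dots> = g (dif H)"
      by (simp add: dif_def emb_prod[OF G_emb[OF gG]] emb_diff[OF G_emb[OF gG]])
    finally have 1: "g (dif H) = (\<Prod>h\<in>H - {g}. g \<pi> - h \<pi>)" by simp
    have "(\<lambda>h. h \<pi>) ` H - {g \<pi>} = (\<lambda>h. h \<pi>) ` (H - {g})"
      using inj g by (auto dest: inj_onD)
    then have "(\<Prod>y\<in>(\<lambda>h. h \<pi>) ` H - {g \<pi>}. g \<pi> - y) = (\<Prod>h\<in>H - {g}. g \<pi> - h \<pi>)"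
      using inj by (simp add: prod.reindex inj_on_diff)
    with 1 show ?thesis by (simp add: emb_divide[OF G_emb[OF gG]] emb_power[OF G_emb[OF gG]])
  qed
  then show ?thesis
    unfolding tr_def lagrange_sum_def by (simp add: sum.reindex[OF inj])
qed

lemma card_pi_image: "subgrp H \<Longrightarrow> card ((\<lambda>h. h \<pi>) ` H) = card H"
  using inj_pi by (intro card_image) (auto simp: subgrp_def intro: inj_on_subset)

text \<open>Write \<open>x = c * (a * y)\<close> with \<open>c\<close> fixed by \<open>H\<close>,
  \<open>a\<close> of trace 1 and \<open>v y = 0\<close>. In the trace of \<open>a * y\<close> the
  constant coefficient of \<open>y\<close> contributes a unit and the rest has positive
  valuation.\<close>

lemma v_tr:
  assumes H: "subgrp H" and x: "x \<noteq> 0"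
    and dvd: "int (card H) dvd v x + (\<Sum>h\<in>H - {id}. brk h)"
  shows "tr H x \<noteq> 0" "v (tr H x) = v x + (\<Sum>h\<in>H - {id}. brk h)"
proof -
  let ?d = "card H" and ?X = "(\<lambda>h. h \<pi>) ` H"
  have HG: "h \<in> G" if "h \<in> H" for h using that H by (auto simp: subgrp_def)
  define m where "m = (v x + (\<Sum>h\<in>H - {id}. brk h)) div int ?d"
  \<comment> \<open>A power of the norm of \<open>\<pi>\<close> to the fixed field of
    \<open>H\<close>. The norm has valuation \<open>card H\<close>, so by the divisibility
    hypothesis \<open>c\<close> has exactly the valuation claimed for the trace.\<close>
  define c where "c = (\<Prod>h\<in>H. h \<pi>) powi m"
  have hpi: "h \<pi> \<noteq> 0" if "h \<in> H" for h using pi_nonzero HG[OF that] emb_eq_0_iff[OF G_emb] by auto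
  have c0: "c \<noteq> 0" using hpi finite_subgrp[OF H] by (auto simp: c_def)
  have "v (\<Prod>h\<in>H. h \<pi>) = int ?d" using hpi HG by (simp add: v_prod v_G v_pi)
  then have vc: "v c = v x + (\<Sum>h\<in>H - {id}. brk h)"
    using dvd hpi finite_subgrp[OF H] by (simp add: c_def v_powi m_def)
  have cfix: "h c = c" if "h \<in> H" for h
    using prod_translate[OF H that, of "\<lambda>t. t \<pi>"] HG[OF that] G_emb
    by (simp add: c_def emb_powi emb_prod)
  define a where "a = \<pi> ^ (?d - 1) / dif H"
  have a0: "a \<noteq> 0" using pi_nonzero dif_nonzero[OF H] by (simp add: a_def)
  have va: "v a = - (\<Sum>h\<in>H - {id}. brk h)"
    using card_subgrp_pos[OF H]
    by (simp add: a_def v_divide v_power v_pi pi_nonzero dif_nonzero[OF H] v_dif[OF H] of_nat_diff)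
  define y where "y = x / (c * a)"
  have y0: "y \<noteq> 0" using x c0 a0 by (simp add: y_def)
  have vy: "v y = 0" using x c0 a0 vc va by (simp add: y_def v_divide v_mult)
  obtain e l where e: "y = (\<Sum>i<q. f (e i) * \<pi> ^ i)" "l < q" "e l \<noteq> 0"
     "v y = v (f (e l)) + int l"
     "\<forall>i<q. i \<noteq> l \<longrightarrow> vge (v y + 1) (f (e i) * \<pi> ^ i)"
    using expansion[of "\<lambda>i. \<pi> ^ i" y, OF pi_powers y0] by blast
  have "int q dvd int l" using dvd_v_base[OF e(3)] e(4) vy by (metis dvd_0_right dvd_add_right_iff)
  then have l0: "l = 0" using e(2) by (metis int_dvd_int_iff nat_dvd_not_less neq0_conv)
  have ve0: "v (f (e 0)) = 0" "f (e 0) \<noteq> 0" using e l0 vy by (auto simp: f_hom)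
  \<comment> \<open>The leading term only yields a valuation above \<open>- int q\<close>; being a
    multiple of \<open>q\<close>, it is nonnegative.\<close>
  have vei: "vge 0 (f (e i))" if "i < q" "i \<noteq> 0" for i
  proof (cases "e i = 0")
    case False
    have "vge 1 (f (e i) * \<pi> ^ i)" using e(5) that l0 vy by auto
    then have "1 \<le> v (f (e i)) + int i"
      using False by (simp add: vge_def f_hom v_mult v_power v_pi pi_nonzero)
    then have "v (f (e i)) > - int q" using that by simp
    then have "v (f (e i)) \<ge> 0" using dvd_v_base[OF False]
      by (metis dvd_minus_iff minus_less_iff not_less zdvd_not_zless neg_0_less_iff_less)
    then show ?thesis by (simp add: vge_def)
  qed (simp add: f_hom)
  have tr_ay: "tr H (a * y) = (\<Sum>i<q. f (e i) * lagrange_sum ?X (?d - 1 + i))"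
  proof -
    have "a * y = (\<Sum>i<q. f (e i) * (\<pi> ^ (?d - 1 + i) / dif H))"
      by (simp add: e(1) a_def sum_distrib_left sum_divide_distrib power_add field_simps)
    then have "tr H (a * y) = (\<Sum>i<q. tr H (f (e i) * (\<pi> ^ (?d - 1 + i) / dif H)))"
      by (simp only: tr_sum[OF H])
    also have "\<dots> = (\<Sum>i<q. f (e i) * lagrange_sum ?X (?d - 1 + i))"
      by (intro sum.cong refl) (subst tr_mult[OF H], use HG G_base tr_pi_power[OF H] in auto)
    finally show ?thesis .
  qed
  also have "\<dots> = f (e 0) + (\<Sum>i\<in>{..<q} - {0}. f (e i) * lagrange_sum ?X (?d - 1 + i))"
    using q_pos card_subgrp_pos[OF H] finite_subgrp[OF H]
    by (subst sum.remove[of _ 0]) (auto simp: lagrange_sum_eq card_pi_image[OF H])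
  finally have split: "tr H (a * y) = \<dots>" .
  have "vge 1 (\<Sum>i\<in>{..<q} - {0}. f (e i) * lagrange_sum ?X (?d - 1 + i))"
  proof (rule vge_sum)
    fix i assume i: "i \<in> {..<q} - {0}"
    have "vge 1 (lagrange_sum ?X (?d - 1 + i))"
      using i finite_subgrp[OF H] HG
      by (intro vge_lagrange_sum) (auto simp: card_pi_image[OF H] vge_G vge_def v_pi v_G)
    then show "vge 1 (f (e i) * lagrange_sum ?X (?d - 1 + i))"
      using vge_mult[of 0 "f (e i)" 1] vei i by auto
  qed
  then have tr0: "tr H (a * y) \<noteq> 0" and vtr: "v (tr H (a * y)) = 0"
    unfolding split using v_add_eq[of "f (e 0)"] ve0 by auto
  have "x = c * (a * y)" using c0 a0 by (simp add: y_def)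
  then have "tr H x = c * tr H (a * y)" using tr_mult[OF H, of c] cfix by simp
  then show "tr H x \<noteq> 0" "v (tr H x) = v x + (\<Sum>h\<in>H - {id}. brk h)"
    using tr0 c0 vtr vc by (auto simp: v_mult)
qed

end

subsection \<open>Polynomials and powers under a valuation\<close>

lemma map_poly_emb_mult:
  assumes "field_embedding s"
  shows "map_poly s (a * b) = map_poly s a * map_poly s b"
  by (rule poly_eqI) (simp add: coeff_map_poly coeff_mult emb_zero[OF assms] emb_sum[OF assms] emb_mult[OF assms])

lemma map_poly_emb_prod:
  assumes "field_embedding s"
  shows "map_poly s (\<Prod>i\<in>I. a i) = (\<Prod>i\<in>I. map_poly s (a i))"
  by (induction I rule: infinite_finite_induct)
    (auto simp: map_poly_emb_mult[OF assms] map_poly_1' emb_one[OF assms])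

lemma degree_prod_linear: "finite I \<Longrightarrow> degree (\<Prod>i\<in>I. [:- a i, 1::'a::field:]) = card I"
  by (subst degree_prod_eq_sum_degree) auto

lemma lead_coeff_prod_linear: "finite I \<Longrightarrow> coeff (\<Prod>i\<in>I. [:- a i, 1::'a::field:]) (card I) = 1"
  using lead_coeff_prod[of "\<lambda>i. [:- a i, 1:]" I] by (simp add: degree_prod_linear)

context valuation
begin

text \<open>Up to sign the coefficients are elementary symmetric in the \<open>a i\<close>. The
  weaker bound 0 from degree \<open>card I\<close> on accommodates the leading coefficient 1 in the
  induction.\<close>

lemma vge_coeff_prod_linear:
  assumes "finite I" "\<And>i. i \<in> I \<Longrightarrow> vge 1 (a i)"
  shows "vge (if k < card I then 1 else 0) (coeff (\<Prod>i\<in>I. [:- a i, 1:]) k)"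
  using assms
proof (induction I arbitrary: k rule: finite_induct)
  case empty
  then show ?case by (simp add: vge_def)
next
  case (insert i I)
  let ?P = "\<Prod>i\<in>I. [:- a i, 1:]"
  have IH: "vge (if k < card I then 1 else 0) (coeff ?P k)" for k using insert by auto
  have "vge 0 (coeff ?P k)" using IH[of k] by (rule vge_mono) auto
  then have 1: "vge 1 (a i * coeff ?P k)" using vge_mult[of 1 "a i" 0] insert by auto
  show ?case
  proof (cases k)
    case 0
    then show ?thesis using insert 1 by (simp add: vge_mono[of 1 _ 0])
  next
    case (Suc j)
    have "vge (if k < card (insert i I) then 1 else 0) (coeff ?P j)"
      using IH[of j] insert Suc by auto
    moreover have "vge (if k < card (insert i I) then 1 else 0) (a i * coeff ?P k)"
      using 1 by (rule vge_mono) auto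
    ultimately have "vge (if k < card (insert i I) then 1 else 0) (coeff ?P j - a i * coeff ?P k)"
      by (rule vge_diff)
    then show ?thesis using insert Suc by simp
  qed
qed

lemma vge_power_diff:
  assumes "a \<noteq> 0" "b \<noteq> 0" "v a = d" "v b = d" "vge m (a - b)"
  shows "vge (m + (int i - 1) * d) (a ^ i - b ^ i)"
proof (cases i)
  case 0
  then show ?thesis by simp
next
  case (Suc j)
  have "vge ((int i - 1) * d) (\<Sum>k<i. b ^ (i - Suc k) * a ^ k)"
  proof (rule vge_sum)
    fix k assume "k \<in> {..<i}"
    then have k: "k < i" by simp
    have "v (b ^ (i - Suc k) * a ^ k) = (int i - 1 - int k) * d + int k * d"
      using assms k by (simp add: v_mult v_power of_nat_diff)
    then show "vge ((int i - 1) * d) (b ^ (i - Suc k) * a ^ k)"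
      by (simp add: vge_def algebra_simps)
  qed
  then show ?thesis
    unfolding power_diff_sumr2 using assms by (intro vge_mult) auto
qed

text \<open>The cofactor of \<open>a - b\<close> in \<open>a ^ i - b ^ i\<close> is
  \<open>of_nat i * b ^ (i - 1)\<close> plus terms containing \<open>a ^ k - b ^ k\<close>. These
  have larger valuation because \<open>v (a - b) > d\<close>, and \<open>of_nat i\<close> is a
  unit.\<close>

lemma v_power_diff:
  assumes ab: "a \<noteq> 0" "b \<noteq> 0" "v a = d" "v b = d" "a \<noteq> b" "v (a - b) > d"
    and i: "of_nat i \<noteq> (0::'n)" "v (of_nat i) = 0"
  shows "a ^ i \<noteq> b ^ i" "v (a ^ i - b ^ i) = v (a - b) + (int i - 1) * d"
proof -
  let ?S = "\<Sum>k<i. b ^ (i - Suc k) * a ^ k"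
  have i0: "i > 0" using i(1) by (cases i) auto
  have "?S = (\<Sum>k<i. b ^ (i - 1) + b ^ (i - Suc k) * (a ^ k - b ^ k))"
    by (intro sum.cong refl) (auto simp: algebra_simps power_add[symmetric])
  also have "\<dots> = of_nat i * b ^ (i - 1) + (\<Sum>k<i. b ^ (i - Suc k) * (a ^ k - b ^ k))"
    by (simp add: sum.distrib)
  finally have S: "?S = \<dots>" .
  have vb: "v (of_nat i * b ^ (i - 1)) = (int i - 1) * d"
    using ab i i0 by (simp add: v_mult v_power of_nat_diff)
  have "vge ((int i - 1) * d + 1) (\<Sum>k<i. b ^ (i - Suc k) * (a ^ k - b ^ k))"
  proof (rule vge_sum)
    fix k assume "k \<in> {..<i}"
    then have k: "k < i" by simp
    have "vge ((int i - 1 - int k) * d) (b ^ (i - Suc k))"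
      using k ab by (simp add: vge_def v_power of_nat_diff algebra_simps)
    moreover have "vge (v (a - b) + (int k - 1) * d) (a ^ k - b ^ k)"
      using ab by (intro vge_power_diff) (auto simp: vge_def)
    ultimately have "vge ((int i - 1 - int k) * d + (v (a - b) + (int k - 1) * d))
        (b ^ (i - Suc k) * (a ^ k - b ^ k))" by (rule vge_mult)
    then show "vge ((int i - 1) * d + 1) (b ^ (i - Suc k) * (a ^ k - b ^ k))"
      by (rule vge_mono) (use ab(6) in \<open>simp add: algebra_simps\<close>)
  qed
  then have S0: "?S \<noteq> 0" and vS: "v ?S = (int i - 1) * d"
    unfolding S using v_add_eq[of "of_nat i * b ^ (i - 1)"] vb ab i by auto
  show "a ^ i \<noteq> b ^ i" "v (a ^ i - b ^ i) = v (a - b) + (int i - 1) * d"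
    using power_diff_sumr2[of a i b] S0 vS ab by (auto simp: v_mult)
qed

end

subsection \<open>Subgroups of index \<open>p\<close>\<close>

context elementary_abelian_extension
begin

text \<open>An inverse of \<open>i\<close> modulo \<open>p\<close> writes 1 as an integral
  combination of \<open>i\<close> and \<open>p\<close>, so these cannot both have positive
  valuation.\<close>

lemma v_of_nat_lt_p:
  assumes "0 < i" "i < p"
  shows "v (of_nat i) = 0"
proof (rule ccontr)
  assume "v (of_nat i) \<noteq> 0"
  then have vi: "vge 1 (of_nat i)" using vge_of_nat[of i] by (auto simp: vge_def)
  have "coprime i p" using assms p_prime by (metis coprime_commute nat_dvd_not_less prime_imp_coprime)
  then obtain m where "[i * m = 1] (mod p)" using cong_solve_coprime_nat by auto
  then have "(i * m) mod p = 1" using p_gt_1 by (simp add: cong_def)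
  then have "i * m = p * (i * m div p) + 1" by (metis mult_div_mod_eq)
  then have "of_nat (i * m) = (of_nat (p * (i * m div p) + 1) :: 'n)" by (rule arg_cong)
  then have "1 = of_nat i * of_nat m - of_nat p * (of_nat (i * m div p) :: 'n)" by (simp add: algebra_simps)
  moreover have "vge (1 + 0) (of_nat i * of_nat m)" "vge (1 + 0) (of_nat p * of_nat (i * m div p))"
    using vge_mult[OF vi vge_of_nat] vge_mult[of 1 "of_nat p", OF _ vge_of_nat] v_p
    by (auto simp: vge_def[of 1 "of_nat p"])
  ultimately have "vge 1 1" using vge_diff by (metis add.right_neutral)
  then show False by (simp add: vge_def)
qed

definition adjoin :: "('n \<Rightarrow> 'n) set \<Rightarrow> ('n \<Rightarrow> 'n) \<Rightarrow> ('n \<Rightarrow> 'n) set" where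
  "adjoin H s = (\<lambda>(i, h). s ^^ i \<circ> h) ` ({..<p} \<times> H)"

text \<open>Two equal products with different exponents would put some \<open>s ^^ (k - i)\<close>
  with \<open>0 < k - i < p\<close> into \<open>H\<close>, and with it \<open>s\<close>.\<close>

lemma adjoin_bij:
  assumes H: "subgrp H" and s: "s \<in> G" "s \<notin> H"
  shows "bij_betw (\<lambda>(i, h). s ^^ i \<circ> h) ({..<p} \<times> H) (adjoin H s)"
proof (rule bij_betw_imageI)
  have HG: "H \<subseteq> G" using H by (simp add: subgrp_def)
  have aux: "i = k" if ik: "i \<le> k" "k < p" "h \<in> H" "h' \<in> H" "s ^^ i \<circ> h = s ^^ k \<circ> h'" for i k h h'
  proof (rule ccontr)
    assume "i \<noteq> k"
    have "s ^^ i \<circ> h = s ^^ i \<circ> (s ^^ (k - i) \<circ> h')"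
      using ik by (simp add: comp_assoc[symmetric] funpow_add[symmetric])
    then have "h = s ^^ (k - i) \<circ> h'"
      using inverse_comp'[OF funpow_G[OF s(1)], of i] by metis
    then have "h \<circ> h' ^^ (p - 1) = s ^^ (k - i) \<circ> (h' \<circ> (h' ^^ (p - 1) \<circ> id))"
      by (simp add: comp_assoc)
    then have "h \<circ> h' ^^ (p - 1) = s ^^ (k - i)"
      using inverse_comp[of h' id] ik HG by auto
    moreover have "h \<circ> h' ^^ (p - 1) \<in> H"
      using H ik subgrp_funpow[OF H] by (auto simp: subgrp_def)
    ultimately have "s \<in> H"
      using subgrp_funpow_cancel[OF H s(1), of "k - i"] ik \<open>i \<noteq> k\<close> by auto
    then show False using s by simp
  qed
  show "inj_on (\<lambda>(i, h). s ^^ i \<circ> h) ({..<p} \<times> H)"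
  proof (rule inj_onI, clarify)
    fix i h k h' assume *: "i < p" "k < p" "h \<in> H" "h' \<in> H" "s ^^ i \<circ> h = s ^^ k \<circ> h'"
    then have "i = k" using aux[of i k h h'] aux[of k i h' h] by (cases "i \<le> k") auto
    moreover have "h = h'" using * \<open>i = k\<close> inverse_comp'[OF funpow_G[OF s(1)], of i] by metis
    ultimately show "i = k \<and> h = h'" by simp
  qed
  show "(\<lambda>(i, h). s ^^ i \<circ> h) ` ({..<p} \<times> H) = adjoin H s" by (simp add: adjoin_def)
qed

lemma adjoin_sum:
  assumes "subgrp H" "s \<in> G" "s \<notin> H"
  shows "(\<Sum>g\<in>adjoin H s. F g) = (\<Sum>i<p. \<Sum>h\<in>H. F (s ^^ i \<circ> h))"
  using sum.reindex_bij_betw[OF adjoin_bij[OF assms], of F]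
  by (simp add: sum.cartesian_product split_def)

text \<open>The class of \<open>s\<close> generates the quotient of \<open>G\<close> by
  \<open>H\<close>, which has order \<open>p\<close>; carrying \<open>s\<close> along turns sums
  over \<open>G\<close> into double sums.\<close>

definition index_p :: "('n \<Rightarrow> 'n) set \<Rightarrow> ('n \<Rightarrow> 'n) \<Rightarrow> bool" where
  "index_p H s \<longleftrightarrow> subgrp H \<and> s \<in> G \<and> s \<notin> H \<and> adjoin H s = G"

lemma index_p_card: "index_p H s \<Longrightarrow> q = p * card H"
  using bij_betw_same_card[OF adjoin_bij] card_G
  by (auto simp: card_cartesian_product index_p_def)

lemma index_p_sum:
  assumes "index_p H s"
  shows "(\<Sum>g\<in>G. F g) = (\<Sum>i<p. \<Sum>h\<in>H. F (s ^^ i \<circ> h))"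
  using adjoin_sum[of H s F] assms by (auto simp: index_p_def)

text \<open>The norm \<open>y\<close> of \<open>x\<close> from the fixed field of \<open>H\<close>
  to the base has valuation \<open>p * v x\<close>, and this is a multiple of
  \<open>q = p * card H\<close>.\<close>

lemma dvd_v_fixed:
  assumes Hs: "index_p H s" and x: "x \<noteq> 0" "\<forall>h\<in>H. h x = x"
  shows "int (card H) dvd v x"
proof -
  have s: "s \<in> G" using Hs by (simp add: index_p_def)
  define y where "y = (\<Prod>i<p. (s ^^ i) x)"
  have nz: "(s ^^ i) x \<noteq> 0" for i using x(1) emb_eq_0_iff[OF G_emb[OF funpow_G[OF s]]] by simp
  \<comment> \<open>The automorphism \<open>s\<close> shifts the factors cyclically, because
    \<open>s ^^ p = id\<close>.\<close>
  have sy: "s y = y"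
  proof -
    have "s y = (\<Prod>i<p. (s ^^ Suc i) x)" by (simp add: y_def emb_prod[OF G_emb[OF s]])
    also have "\<dots> * (s ^^ 0) x = (\<Prod>i<Suc p. (s ^^ i) x)"
      by (simp only: prod.lessThan_Suc_shift mult.commute)
    also have "\<dots> = y * (s ^^ p) x" by (simp add: y_def)
    also have "\<dots> = y * x" using funpow_p[OF s] by simp
    finally show ?thesis using x(1) by simp
  qed
  then have siy: "(s ^^ i) y = y" for i by (induction i) auto
  have hy: "h y = y" if h: "h \<in> H" for h
  proof -
    have hG: "h \<in> G" using h Hs by (auto simp: index_p_def subgrp_def)
    have "h ((s ^^ i) x) = (s ^^ i) x" for i
      using comm_G'[OF hG funpow_G[OF s]] x(2) h by metis
    then show ?thesis by (simp add: y_def emb_prod[OF G_emb[OF hG]])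
  qed
  have "y \<in> range f"
  proof (rule fixed_G)
    fix g assume "g \<in> G"
    then have "g \<in> adjoin H s" using Hs by (simp add: index_p_def)
    then obtain i h where "g = s ^^ i \<circ> h" "h \<in> H" by (auto simp: adjoin_def)
    then show "g y = y" using hy[of h] siy[of i] by simp
  qed
  then obtain c where c: "y = f c" by auto
  have "y \<noteq> 0" using nz by (simp add: y_def)
  then have "int q dvd v y" using dvd_v_base[of c] c by (auto simp: f_hom)
  moreover have "v y = int p * v x" using nz funpow_G[OF s] by (simp add: y_def v_prod v_G)
  ultimately show ?thesis using index_p_card[OF Hs] p_gt_1 by simp
qed

section \<open>Ramification in the fixed field of a subgroup of index p\<close>

definition min_poly :: "('n \<Rightarrow> 'n) set \<Rightarrow> 'n poly" where
  "min_poly H = (\<Prod>h\<in>H. [:- h \<pi>, 1:])"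

text \<open>A prime element of the fixed field of \<open>H\<close>.\<close>

definition pi_fix :: "('n \<Rightarrow> 'n) set \<Rightarrow> 'n" where
  "pi_fix H = coeff (min_poly H) 0"

lemma map_poly_min_poly:
  assumes "s \<in> G"
  shows "map_poly s (min_poly H) = (\<Prod>h\<in>H. [:- (s \<circ> h) \<pi>, 1:])"
  unfolding min_poly_def map_poly_emb_prod[OF G_emb[OF assms]]
  by (intro prod.cong refl)
    (simp add: map_poly_pCons emb_zero[OF G_emb[OF assms]] emb_one[OF G_emb[OF assms]] emb_neg[OF G_emb[OF assms]])

lemma coeff_min_poly_fixed:
  assumes "subgrp H" "h \<in> H"
  shows "h (coeff (min_poly H) k) = coeff (min_poly H) k"
proof -
  have h: "h \<in> G" using assms by (auto simp: subgrp_def)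
  have "map_poly h (min_poly H) = min_poly H"
    using prod_translate[OF assms, where F = "\<lambda>t. [:- t \<pi>, 1:]"]
    by (simp only: map_poly_min_poly[OF h]) (simp only: min_poly_def)
  then show ?thesis by (metis coeff_map_poly emb_zero[OF G_emb[OF h]])
qed

lemma pi_fix:
  assumes "subgrp H"
  shows "pi_fix H \<noteq> 0" "v (pi_fix H) = int (card H)" "h \<in> H \<Longrightarrow> h (pi_fix H) = pi_fix H"
proof -
  have nz: "- h \<pi> \<noteq> 0" and v: "v (- h \<pi>) = 1" if "h \<in> H" for h
    using that assms pi_nonzero emb_eq_0_iff[OF G_emb] by (auto simp: subgrp_def v_G v_pi)
  have "poly (min_poly H) 0 = (\<Prod>h\<in>H. - h \<pi>)" by (simp add: min_poly_def poly_prod)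
  then have eq: "pi_fix H = (\<Prod>h\<in>H. - h \<pi>)" by (simp add: pi_fix_def poly_0_coeff_0)
  show "pi_fix H \<noteq> 0" unfolding eq using nz finite_subgrp[OF assms] by auto
  show "v (pi_fix H) = int (card H)" unfolding eq using nz v by (subst v_prod) auto
  show "h \<in> H \<Longrightarrow> h (pi_fix H) = pi_fix H"
    unfolding pi_fix_def by (rule coeff_min_poly_fixed[OF assms])
qed

text \<open>The \<open>w j\<close> have valuation \<open>j\<close> and so span. The part
  \<open>y\<close> of \<open>x\<close> with indices not divisible by \<open>card H\<close> is
  \<open>x\<close> minus a combination of powers of \<open>pi_fix H\<close>, hence fixed by
  \<open>H\<close>; if nonzero, its valuation would not be divisible by \<open>card H\<close>,
  against \<open>dvd_v_fixed\<close>.\<close>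

lemma fixed_expansion:
  assumes Hs: "index_p H s" and x: "x \<noteq> 0" "\<forall>h\<in>H. h x = x"
  obtains e l where "x = (\<Sum>i<p. f (e i) * pi_fix H ^ i)" "l < p" "e l \<noteq> 0"
    "v x = v (f (e l)) + int l * int (card H)"
    "\<forall>i<p. i \<noteq> l \<longrightarrow> vge (v x + 1) (f (e i) * pi_fix H ^ i)"
proof -
  let ?d = "card H" and ?P = "pi_fix H"
  have H: "subgrp H" and HG: "H \<subseteq> G" using Hs by (auto simp: index_p_def subgrp_def)
  have d: "?d > 0" by (rule card_subgrp_pos[OF H])
  have q: "q = p * ?d" by (rule index_p_card[OF Hs])
  define w where "w j = ?P ^ (j div ?d) * \<pi> ^ (j mod ?d)" for j
  have w: "w j \<noteq> 0 \<and> v (w j) = int j" for j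
  proof -
    have "v (w j) = int (j div ?d) * int ?d + int (j mod ?d)"
      using pi_fix[OF H] pi_nonzero by (simp add: w_def v_mult v_power v_pi)
    also have "\<dots> = int j" by (metis div_mult_mod_eq of_nat_add of_nat_mult)
    finally show ?thesis using pi_fix[OF H] pi_nonzero by (simp add: w_def)
  qed
  obtain c where c: "x = (\<Sum>j<q. f (c j) * w j)" using expansion_ex[of w x] w by blast
  define c' where "c' j = (if ?d dvd j then 0 else c j)" for j
  define y where "y = (\<Sum>j<q. f (c' j) * w j)"
  define e where "e i = c (i * ?d)" for i
  have img: "{j\<in>{..<q}. ?d dvd j} = (\<lambda>i. i * ?d) ` {..<p}"
    using d q by (auto simp: dvd_def mult.commute)
  have inj: "inj_on (\<lambda>i. i * ?d) {..<p}" using d by (auto simp: inj_on_def)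
  have "x - y = (\<Sum>j<q. if ?d dvd j then f (c j) * w j else 0)"
    unfolding c y_def sum_subtractf[symmetric]
    by (intro sum.cong refl) (auto simp: c'_def f_hom)
  also have "\<dots> = (\<Sum>j\<in>{j\<in>{..<q}. ?d dvd j}. f (c j) * w j)"
    by (subst sum.inter_filter) auto
  also have "\<dots> = (\<Sum>i<p. f (e i) * ?P ^ i)"
    unfolding img using d by (simp add: sum.reindex[OF inj] e_def w_def)
  finally have xy: "x - y = (\<Sum>i<p. f (e i) * ?P ^ i)" .
  have yfix: "h y = y" if "h \<in> H" for h
  proof -
    have h: "field_embedding h" "h \<in> G" using that HG G_emb by auto
    have "h (x - y) = x - y"
      unfolding xy using pi_fix(3)[OF H that] h
      by (simp add: emb_sum[OF h(1)] emb_mult[OF h(1)] emb_power[OF h(1)] G_base)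
    moreover have "h x = x" using x(2) that by blast
    ultimately show ?thesis by (simp add: emb_diff[OF h(1)])
  qed
  have "y = 0"
  proof (rule ccontr)
    assume y0: "y \<noteq> 0"
    have "\<exists>k<q. c' k \<noteq> 0"
    proof (rule ccontr)
      assume "\<not> ?thesis"
      then have "y = 0" unfolding y_def by (simp add: f_hom)
      then show False using y0 by simp
    qed
    then obtain k where k: "k < q" "c' k \<noteq> 0" by blast
    obtain l where l: "c' l \<noteq> 0" "v y = v (f (c' l)) + int l"
      using expansion_valuation[of w k c'] w k unfolding y_def by blast
    have "int ?d dvd v y" using dvd_v_fixed[OF Hs y0] yfix by blast
    moreover have "int ?d dvd v (f (c' l))"
      using dvd_v_base[OF l(1)] q by (metis dvd_mult_right of_nat_mult)
    ultimately have "int ?d dvd int l" using l(2) by (simp add: dvd_add_right_iff)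
    then show False using l(1) by (simp add: c'_def)
  qed
  then have xe: "x = (\<Sum>i<p. f (e i) * ?P ^ i)" using xy by simp
  have "\<exists>k<p. e k \<noteq> 0"
  proof (rule ccontr)
    assume "\<not> ?thesis"
    then have "x = 0" unfolding xe by (simp add: f_hom)
    then show False using x by simp
  qed
  then obtain k where k: "k < p" "e k \<noteq> 0" by blast
  have vt: "v (f (e i) * ?P ^ i) = v (f (e i)) + int i * int ?d" if "e i \<noteq> 0" for i
    using that pi_fix[OF H] by (simp add: v_mult v_power f_hom)
  obtain l where l: "l \<in> {..<p}" "f (e l) * ?P ^ l \<noteq> 0"
    "v (\<Sum>i<p. f (e i) * ?P ^ i) = v (f (e l) * ?P ^ l)"
    "\<And>i. i \<in> {..<p} \<Longrightarrow> i \<noteq> l \<Longrightarrow> vge (v (f (e l) * ?P ^ l) + 1) (f (e i) * ?P ^ i)"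
  proof (rule v_sum_distinct[of "{..<p}" k "\<lambda>i. f (e i) * ?P ^ i"])
    fix i m assume im: "i \<in> {..<p}" "m \<in> {..<p}" "f (e i) * ?P ^ i \<noteq> 0" "f (e m) * ?P ^ m \<noteq> 0"
      "v (f (e i) * ?P ^ i) = v (f (e m) * ?P ^ m)"
    then have e0: "e i \<noteq> 0" "e m \<noteq> 0" by (auto simp: f_hom)
    have "(int i - int m) * int ?d = v (f (e m)) - v (f (e i))"
      using im(5) vt[OF e0(1)] vt[OF e0(2)] by (simp add: algebra_simps)
    moreover have "int q dvd v (f (e m)) - v (f (e i))"
      using e0 by (intro dvd_diff dvd_v_base)
    ultimately have "int p * int ?d dvd (int i - int m) * int ?d" using q by simp
    then have "int p dvd int i - int m" using d by simp
    then have "int i mod int p = int m mod int p" by (simp add: mod_eq_dvd_iff)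
    then show "i = m" using im by simp
  qed (use k pi_fix[OF H] in \<open>auto simp: f_hom\<close>)
  then have el: "e l \<noteq> 0" by (auto simp: f_hom)
  show thesis
    by (rule that[OF xe _ el]) (use l vt[OF el] xe in auto)
qed

text \<open>On each term of the expansion in powers of \<open>pi_fix H\<close>, \<open>s - 1\<close>
  raises the valuation by at least \<open>r\<close>. On the leading term, of exponent
  \<open>l\<close>, the gain is exactly \<open>r\<close> if \<open>0 < l < p\<close>, since
  \<open>of_nat l\<close> is then a unit; \<open>l = 0\<close> would make \<open>q\<close> divide
  \<open>v x\<close>.\<close>

lemma diff_fixed:
  assumes Hs: "index_p H s" and x: "x \<noteq> 0" "\<forall>h\<in>H. h x = x"
    and r: "vge (r + int (card H)) (s (pi_fix H) - pi_fix H)"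
  shows "vge (v x + r) (s x - x)"
    and "r > 0 \<Longrightarrow> s (pi_fix H) \<noteq> pi_fix H \<Longrightarrow> v (s (pi_fix H) - pi_fix H) = r + int (card H) \<Longrightarrow>
      \<not> int q dvd v x \<Longrightarrow> s x \<noteq> x \<and> v (s x - x) = v x + r"
proof -
  let ?d = "int (card H)" and ?P = "pi_fix H"
  have H: "subgrp H" and s: "s \<in> G" using Hs by (auto simp: index_p_def)
  note es = G_emb[OF s]
  obtain e l where e: "x = (\<Sum>i<p. f (e i) * ?P ^ i)" "l < p" "e l \<noteq> 0"
    "v x = v (f (e l)) + int l * ?d"
    "\<forall>i<p. i \<noteq> l \<longrightarrow> vge (v x + 1) (f (e i) * ?P ^ i)"
    using fixed_expansion[of H s x, OF Hs x] by blast
  have sx: "s x - x = (\<Sum>i<p. f (e i) * (s ?P ^ i - ?P ^ i))"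
  proof -
    have "s x = (\<Sum>i<p. f (e i) * s ?P ^ i)"
      by (subst e(1)) (simp add: emb_sum[OF es] emb_mult[OF es] emb_power[OF es] G_base[OF s])
    then show ?thesis by (subst (2) e(1)) (simp add: sum_subtractf[symmetric] algebra_simps)
  qed
  have P: "s ?P \<noteq> 0" "?P \<noteq> 0" "v (s ?P) = ?d" "v ?P = ?d"
    using pi_fix[OF H] v_G[OF s] emb_eq_0_iff[OF es] by auto
  have trm: "vge (m + r) (f (e i) * (s ?P ^ i - ?P ^ i))" if "vge m (f (e i) * ?P ^ i)" for i m
  proof (cases "e i = 0")
    case False
    have "vge (r + ?d + (int i - 1) * ?d) (s ?P ^ i - ?P ^ i)"
      by (rule vge_power_diff[OF P r])
    then have "vge (v (f (e i)) + (r + ?d + (int i - 1) * ?d)) (f (e i) * (s ?P ^ i - ?P ^ i))"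
      by (intro vge_mult) (auto simp: vge_def)
    moreover have "m \<le> v (f (e i)) + int i * ?d"
      using that False P by (auto simp: vge_def f_hom v_mult v_power)
    ultimately show ?thesis by (elim vge_mono) (simp add: algebra_simps)
  qed (simp add: f_hom)
  have vl: "v (f (e l) * ?P ^ l) = v x" using e P by (simp add: v_mult v_power f_hom)
  show "vge (v x + r) (s x - x)"
    unfolding sx
  proof (rule vge_sum)
    fix i assume "i \<in> {..<p}"
    then have "vge (v x) (f (e i) * ?P ^ i)"
      using e(5) vl by (cases "i = l") (auto simp: vge_def)
    then show "vge (v x + r) (f (e i) * (s ?P ^ i - ?P ^ i))" by (rule trm)
  qed
  assume r0: "r > 0" and sP: "s ?P \<noteq> ?P" and vr: "v (s ?P - ?P) = r + ?d" and nd: "\<not> int q dvd v x"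
  have l0: "0 < l"
  proof (rule ccontr)
    assume "\<not> 0 < l"
    then show False using nd e(4) dvd_v_base[OF e(3)] by simp
  qed
  then have ol: "of_nat l \<noteq> (0::'n)" "v (of_nat l) = 0" using e(2) v_of_nat_lt_p[of l] by auto
  have "s ?P ^ l \<noteq> ?P ^ l" "v (s ?P ^ l - ?P ^ l) = v (s ?P - ?P) + (int l - 1) * ?d"
    using v_power_diff[OF P sP _ ol] vr r0 by auto
  then have lead: "f (e l) * (s ?P ^ l - ?P ^ l) \<noteq> 0" "v (f (e l) * (s ?P ^ l - ?P ^ l)) = v x + r"
    using e(3,4) vr v_mult[of "f (e l)" "s ?P ^ l - ?P ^ l"] by (auto simp: f_hom algebra_simps)
  have "vge (v x + r + 1) (\<Sum>i\<in>{..<p} - {l}. f (e i) * (s ?P ^ i - ?P ^ i))"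
  proof (rule vge_sum)
    fix i assume i: "i \<in> {..<p} - {l}"
    have "vge (v x + 1 + r) (f (e i) * (s ?P ^ i - ?P ^ i))" by (rule trm) (use e(5) i in auto)
    then show "vge (v x + r + 1) (f (e i) * (s ?P ^ i - ?P ^ i))" by (simp add: algebra_simps)
  qed
  moreover have "s x - x = f (e l) * (s ?P ^ l - ?P ^ l) + (\<Sum>i\<in>{..<p} - {l}. f (e i) * (s ?P ^ i - ?P ^ i))"
    unfolding sx using e(2) by (subst sum.remove[of _ l]) auto
  ultimately show "s x \<noteq> x \<and> v (s x - x) = v x + r"
    using v_add_eq[OF lead(1)] lead(2) by auto
qed


text \<open>
  Herbrand's theorem for a quotient of order \<open>p\<close>: evaluate at \<open>\<pi>\<close> the difference between the
  minimal polynomial of \<open>\<pi>\<close> over the fixed field of \<open>H\<close> and its image under \<open>s\<close>. The constant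
  coefficient dominates.
\<close>

lemma herbrand:
  assumes Hs: "index_p H s"
  shows "s (pi_fix H) \<noteq> pi_fix H"
    and "v (s (pi_fix H) - pi_fix H) = int (card H) + (\<Sum>h\<in>H. brk (s \<circ> h))"
proof -
  let ?d = "int (card H)" and ?P = "pi_fix H" and ?F = "min_poly H"
  have H: "subgrp H" and s: "s \<in> G" "s \<notin> H" and HG: "H \<subseteq> G"
    using Hs by (auto simp: index_p_def subgrp_def)
  note es = G_emb[OF s(1)] and fin = finite_subgrp[OF H]
  have sh: "s \<circ> h \<noteq> id" "s \<circ> h \<in> G" if h: "h \<in> H" for h
  proof -
    show "s \<circ> h \<in> G" using h HG s comp_G by auto
    show "s \<circ> h \<noteq> id"
    proof
      assume "s \<circ> h = id"
      have hG: "h \<in> G" using h HG by auto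
      have "s = s \<circ> (h \<circ> (h ^^ (p - 1) \<circ> id))" using inverse_comp[OF hG, of id] by simp
      also have "\<dots> = (s \<circ> h) \<circ> h ^^ (p - 1)" by (simp add: comp_assoc)
      also have "\<dots> = h ^^ (p - 1)" using \<open>s \<circ> h = id\<close> by simp
      also have "\<dots> \<in> H" by (rule subgrp_funpow[OF H h])
      finally show False using s by simp
    qed
  qed
  have nz: "\<pi> - (s \<circ> h) \<pi> \<noteq> 0" if "h \<in> H" for h using G_pi_eq[OF sh(2)[OF that]] sh(1)[OF that] by auto
  define D where "D = map_poly s ?F - ?F"
  have cD: "coeff D k = s (coeff ?F k) - coeff ?F k" for k
    by (simp add: D_def coeff_map_poly emb_zero[OF es])
  have "poly ?F \<pi> = 0"
    using fin H by (auto simp: min_poly_def poly_prod subgrp_def intro!: prod_zero bexI[of _ id])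
  then have pD: "poly D \<pi> = (\<Prod>h\<in>H. \<pi> - (s \<circ> h) \<pi>)"
    by (simp add: D_def map_poly_min_poly[OF s(1)] poly_prod)
  have pD0: "poly D \<pi> \<noteq> 0" unfolding pD using nz fin by auto
  have vD: "v (poly D \<pi>) = ?d + (\<Sum>h\<in>H. brk (s \<circ> h))"
    unfolding pD using nz v_prod[of H "\<lambda>h. \<pi> - (s \<circ> h) \<pi>"]
    by (simp add: brk_def v_minus_commute[of \<pi>] sum_subtractf)
  have "coeff D 0 = s ?P - ?P" by (simp add: cD pi_fix_def)
  then have split: "poly D \<pi> = (s ?P - ?P) + (\<Sum>k\<in>{..degree D} - {0}. coeff D k * \<pi> ^ k)"
    unfolding poly_altdef by (subst sum.remove[of _ 0]) auto
  \<comment> \<open>A bound \<open>r\<close> for the constant coefficient carries over to the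
    coefficients of \<open>D\<close> at \<open>k > 0\<close>: the nonzero ones of \<open>?F\<close>
    below degree \<open>card H\<close> are fixed by \<open>H\<close> and have positive valuation,
    hence at least \<open>card H\<close>, so \<open>diff_fixed\<close> applies. The factor
    \<open>\<pi> ^ k\<close> adds 1.\<close>
  have rest: "vge (r + ?d + 1) (\<Sum>k\<in>{..degree D} - {0}. coeff D k * \<pi> ^ k)"
    if r: "vge (r + ?d) (s ?P - ?P)" for r
  proof (rule vge_sum)
    fix k assume k: "k \<in> {..degree D} - {0}"
    have "vge (r + ?d) (coeff D k)"
    proof (cases "coeff ?F k = 0 \<or> k \<ge> card H")
      case True
      have "coeff ?F k = 0 \<or> coeff ?F k = 1"
        using True lead_coeff_prod_linear[OF fin, of "\<lambda>h. h \<pi>"] degree_prod_linear[OF fin, of "\<lambda>h. h \<pi>"]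
          coeff_eq_0[of ?F k]
        by (cases "k = card H") (auto simp: min_poly_def)
      then show ?thesis by (auto simp: cD emb_zero[OF es] emb_one[OF es])
    next
      case False
      have F0: "coeff ?F k \<noteq> 0" and Ffix: "\<forall>h\<in>H. h (coeff ?F k) = coeff ?F k"
        using False coeff_min_poly_fixed[OF H] by auto
      have "vge 1 (h \<pi>)" if "h \<in> H" for h using that HG by (auto simp: vge_def v_G v_pi)
      then have "vge 1 (coeff ?F k)"
        using vge_coeff_prod_linear[OF fin, of "\<lambda>h. h \<pi>" k] False by (auto simp: min_poly_def)
      then have "?d \<le> v (coeff ?F k)"
        using dvd_v_fixed[OF Hs F0 Ffix] F0 by (auto simp: vge_def intro: zdvd_imp_le)
      then show ?thesis
        using diff_fixed(1)[OF Hs F0 Ffix r] by (auto simp: cD elim: vge_mono)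
    qed
    moreover have "vge 1 (\<pi> ^ k)" using k by (auto simp: vge_def v_power pi_nonzero v_pi)
    ultimately show "vge (r + ?d + 1) (coeff D k * \<pi> ^ k)" by (rule vge_mult)
  qed
  \<comment> \<open>If \<open>s\<close> fixed \<open>pi_fix H\<close>, the bound would hold for
    every \<open>r\<close>, and \<open>poly D \<pi>\<close> would have a valuation larger than its
    own.\<close>
  show neq: "s ?P \<noteq> ?P"
  proof
    assume eq: "s ?P = ?P"
    then have "vge (v (poly D \<pi>) + 1) (poly D \<pi>)"
      using rest[of "v (poly D \<pi>) - ?d"] split by simp
    then show False using pD0 by (simp add: vge_def)
  qed
  have "vge (v (s ?P - ?P) + 1) (\<Sum>k\<in>{..degree D} - {0}. coeff D k * \<pi> ^ k)"
    using rest[of "v (s ?P - ?P) - ?d"] by (simp add: vge_def)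
  then have "v (poly D \<pi>) = v (s ?P - ?P)"
    unfolding split using neq by (intro v_add_eq(2)) auto
  then show "v (s ?P - ?P) = ?d + (\<Sum>h\<in>H. brk (s \<circ> h))" using vD by simp
qed

text \<open>The sharp half of \<open>diff_fixed\<close> applies as long as \<open>q\<close> does not
  divide the valuation reached so far. Commutativity of \<open>G\<close> keeps each difference fixed
  by \<open>H\<close>.\<close>

lemma v_iterated_diff:
  assumes Hs: "index_p H s" and x: "x \<noteq> 0" "\<forall>h\<in>H. h x = x"
    and r: "r = (\<Sum>h\<in>H. brk (s \<circ> h))" "r > 0"
    and nd: "\<And>k. Suc k < p \<Longrightarrow> \<not> int q dvd v x + int k * r"
    and k: "k < p"
  shows "((\<lambda>y. s y - y) ^^ k) x \<noteq> 0 \<and> (\<forall>h\<in>H. h (((\<lambda>y. s y - y) ^^ k) x) = ((\<lambda>y. s y - y) ^^ k) x) \<and>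
    v (((\<lambda>y. s y - y) ^^ k) x) = v x + int k * r"
  using k
proof (induction k)
  case 0
  then show ?case using x by simp
next
  case (Suc k)
  let ?y = "((\<lambda>y. s y - y) ^^ k) x"
  have y: "?y \<noteq> 0" "\<forall>h\<in>H. h ?y = ?y" "v ?y = v x + int k * r" using Suc by auto
  have s: "s \<in> G" and HG: "H \<subseteq> G" using Hs by (auto simp: index_p_def subgrp_def)
  have "s ?y \<noteq> ?y \<and> v (s ?y - ?y) = v ?y + r"
    using diff_fixed(2)[OF Hs y(1,2), of r] herbrand[OF Hs] r nd[OF Suc.prems] y(3)
    by (auto simp: vge_def)
  moreover have "h (s ?y - ?y) = s ?y - ?y" if "h \<in> H" for h
  proof -
    have h: "h \<in> G" using that HG by auto
    have hy: "h ?y = ?y" using y(2) that by blast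
    then have "h (s ?y) = s ?y" using comm_G'[OF h s, of ?y] by simp
    then show ?thesis using hy by (simp add: emb_diff[OF G_emb[OF h]])
  qed
  ultimately show ?case using y(3) by (auto simp: algebra_simps)
qed

text \<open>The binomial theorem for \<open>s = 1 + (s - 1)\<close>.\<close>

lemma funpow_binomial:
  assumes s: "s \<in> G"
  shows "(s ^^ i) x = (\<Sum>k\<le>i. of_nat (i choose k) * ((\<lambda>y. s y - y) ^^ k) x)"
proof -
  define a where "a k = ((\<lambda>y. s y - y) ^^ k) x" for k
  have sa: "s (a k) = a k + a (Suc k)" for k by (simp add: a_def)
  have "(s ^^ i) x = (\<Sum>k\<le>i. of_nat (i choose k) * a k)"
  proof (induction i)
    case 0
    then show ?case by (simp add: a_def)
  next
    case (Suc i)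
    have "(s ^^ Suc i) x = (\<Sum>k\<le>i. of_nat (i choose k) * (a k + a (Suc k)))"
      using Suc G_emb[OF s] by (simp add: emb_sum emb_mult emb_of_nat sa)
    also have "\<dots> = (\<Sum>k\<le>i. of_nat (i choose k) * a k) + (\<Sum>k\<le>i. of_nat (i choose k) * a (Suc k))"
      by (simp only: distrib_left sum.distrib)
    also have "(\<Sum>k\<le>i. of_nat (i choose k) * a k) = (\<Sum>k\<le>Suc i. of_nat (i choose k) * a k)"
      by (simp add: binomial_eq_0)
    also have "\<dots> = a 0 + (\<Sum>k\<le>i. of_nat (i choose Suc k) * a (Suc k))"
      by (subst sum.atMost_Suc_shift) simp
    also have "\<dots> + (\<Sum>k\<le>i. of_nat (i choose k) * a (Suc k))
        = (\<Sum>k\<le>Suc i. of_nat (Suc i choose k) * a k)"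
      by (subst sum.atMost_Suc_shift) (simp add: sum.distrib algebra_simps)
    finally show ?case .
  qed
  then show ?thesis by (simp add: a_def)
qed

text \<open>The iterated differences \<open>(s - 1)\<^sup>k x\<close> have valuations that are pairwise incongruent modulo \<open>q\<close>.\<close>

lemma conjugates_independent:
  assumes Hs: "index_p H s" and x: "x \<noteq> 0" "\<forall>h\<in>H. h x = x"
    and u: "(\<Sum>h\<in>H. brk (s \<circ> h)) = int (card H) * u" "u > 0" "coprime u (int p)"
    and vx: "v x = int (card H) * w" "[w = u] (mod int p)"
    and zero: "(\<Sum>i<p. f (C i) * (s ^^ i) x) = 0"
  shows "\<forall>i<p. C i = 0"
proof (rule ccontr)
  let ?d = "int (card H)" and ?a = "\<lambda>k. ((\<lambda>y. s y - y) ^^ k) x"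
  assume "\<not> ?thesis"
  then have ne: "{i. i < p \<and> C i \<noteq> 0} \<noteq> {}" by auto
  have s: "s \<in> G" and H: "subgrp H" using Hs by (auto simp: index_p_def)
  have d: "card H > 0" and q: "int q = int p * ?d"
    using card_subgrp_pos[OF H] index_p_card[OF Hs] by auto
  \<comment> \<open>Modulo \<open>p\<close>, \<open>w + k * u\<close> is congruent to
    \<open>(k + 1) * u\<close>, where \<open>0 < k + 1 < p\<close>.\<close>
  have nd: "\<not> int q dvd v x + int k * (?d * u)" if "Suc k < p" for k
  proof
    assume "int q dvd v x + int k * (?d * u)"
    then have "int p * ?d dvd (w + int k * u) * ?d" using vx q by (simp add: algebra_simps)
    then have "int p dvd w + int k * u" using d by simp
    moreover have "[w + int k * u = u + int k * u] (mod int p)" using vx(2) by (intro cong_add) auto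
    ultimately have "int p dvd int (Suc k) * u"
      by (simp add: cong_dvd_iff algebra_simps)
    then have "int p dvd int (Suc k)" using u(3) by (simp add: coprime_commute coprime_dvd_mult_left_iff)
    then show False using that by (metis int_dvd_int_iff nat_dvd_not_less zero_less_Suc)
  qed
  have va: "?a k \<noteq> 0" "v (?a k) = v x + int k * (?d * u)" if "k < p" for k
    using v_iterated_diff[OF Hs x, of "?d * u" k] u d nd that by auto
  \<comment> \<open>The coefficients of the relation in terms of the iterated differences. The
    change of basis is unitriangular, so \<open>D m = C m\<close> at the largest \<open>m\<close>
    with \<open>C m \<noteq> 0\<close>.\<close>
  define D where "D k = (\<Sum>i<p. C i * of_nat (i choose k))" for k
  have sx: "(s ^^ i) x = (\<Sum>k<p. of_nat (i choose k) * ?a k)" if "i < p" for i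
    unfolding funpow_binomial[OF s]
    by (rule sum.mono_neutral_left) (use that in \<open>auto simp: binomial_eq_0\<close>)
  have "(\<Sum>i<p. f (C i) * (s ^^ i) x) = (\<Sum>i<p. \<Sum>k<p. f (C i) * (of_nat (i choose k) * ?a k))"
    by (intro sum.cong refl) (simp add: sx sum_distrib_left)
  also have "\<dots> = (\<Sum>k<p. f (D k) * ?a k)"
    by (subst sum.swap) (simp add: D_def f_hom sum_distrib_right mult.assoc)
  finally have zero': "(\<Sum>k<p. f (D k) * ?a k) = 0" using zero by simp
  define m where "m = Max {i. i < p \<and> C i \<noteq> 0}"
  have m: "m < p" "C m \<noteq> 0" using Max_in[OF _ ne] by (auto simp: m_def)
  have max: "C i = 0" if "i < p" "i > m" for i
    using that Max_ge[of "{i. i < p \<and> C i \<noteq> 0}" i] by (fastforce simp: m_def)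
  have "D m = (\<Sum>i\<in>{m}. C i * of_nat (i choose m))"
    unfolding D_def
  proof (rule sum.mono_neutral_right)
    show "\<forall>i\<in>{..<p} - {m}. C i * of_nat (i choose m) = 0"
    proof
      fix i assume "i \<in> {..<p} - {m}"
      then show "C i * of_nat (i choose m) = 0"
        using max[of i] by (cases "i > m") (auto simp: binomial_eq_0)
    qed
  qed (use m in auto)
  then have Dm: "D m \<noteq> 0" using m by simp
  have "(\<Sum>k<p. f (D k) * ?a k) \<noteq> 0"
  \<comment> \<open>Modulo \<open>q\<close> the terms have valuations
    \<open>v x + k * card H * u\<close>, distinct for \<open>k < p\<close> because \<open>u\<close>
    is prime to \<open>p\<close>.\<close>
  proof (rule v_sum_distinct[of "{..<p}" m "\<lambda>k. f (D k) * ?a k"])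
    fix i k assume ik: "i \<in> {..<p}" "k \<in> {..<p}" "f (D i) * ?a i \<noteq> 0" "f (D k) * ?a k \<noteq> 0"
      "v (f (D i) * ?a i) = v (f (D k) * ?a k)"
    have D0: "D i \<noteq> 0" "D k \<noteq> 0" using ik by (auto simp: f_hom)
    have "v (f (D i)) + int i * (?d * u) = v (f (D k)) + int k * (?d * u)"
      using ik va[of i] va[of k] by (simp add: v_mult)
    then have "(int i - int k) * u * ?d = v (f (D k)) - v (f (D i))" by (simp add: algebra_simps)
    moreover have "int q dvd v (f (D k)) - v (f (D i))" using D0 by (intro dvd_diff dvd_v_base)
    ultimately have "int p * ?d dvd (int i - int k) * u * ?d" using q by simp
    then have "int p dvd (int i - int k) * u" using d by simp
    then have "int p dvd int i - int k" using u(3) by (simp add: coprime_commute coprime_dvd_mult_left_iff)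
    then have "int i mod int p = int k mod int p" by (simp add: mod_eq_dvd_iff)
    then show "i = k" using ik by simp
  qed (use m Dm va[of m] in \<open>auto simp: f_hom\<close>)
  then show False using zero' by simp
qed


section \<open>Generated subgroups and coset sums\<close>

lemma adjoinI: "s \<in> G \<Longrightarrow> h \<in> H \<Longrightarrow> s ^^ i \<circ> h \<in> adjoin H s"
proof -
  assume "s \<in> G" "h \<in> H"
  then have "(i mod p, h) \<in> {..<p} \<times> H" using p_gt_1 by simp
  then have "s ^^ (i mod p) \<circ> h \<in> adjoin H s" unfolding adjoin_def by force
  then show ?thesis by (simp add: funpow_mod_p[OF \<open>s \<in> G\<close>])
qed

lemma adjoin:
  assumes H: "subgrp H" and s: "s \<in> G"
  shows "subgrp (adjoin H s)" "H \<subseteq> adjoin H s" "s \<in> adjoin H s"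
proof -
  have HG: "H \<subseteq> G" "id \<in> H" using H by (auto simp: subgrp_def)
  show sub: "H \<subseteq> adjoin H s" using adjoinI[OF s, of _ H 0] by auto
  show "s \<in> adjoin H s" using adjoinI[OF s HG(2), of 1] by simp
  have "adjoin H s \<subseteq> G" using HG s by (auto simp: adjoin_def intro: comp_G funpow_G)
  moreover have "x \<circ> y \<in> adjoin H s" if xy: "x \<in> adjoin H s" "y \<in> adjoin H s" for x y
  proof -
    obtain i h k h' where x: "x = s ^^ i \<circ> h" "h \<in> H" and y: "y = s ^^ k \<circ> h'" "h' \<in> H"
      using xy by (auto simp: adjoin_def)
    have "h \<circ> s ^^ k = s ^^ k \<circ> h" using x HG s by (intro comm_G funpow_G) auto
    then have "x \<circ> y = s ^^ i \<circ> (s ^^ k \<circ> h) \<circ> h'" unfolding x y by (metis comp_assoc)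
    also have "\<dots> = s ^^ (i + k) \<circ> (h \<circ> h')" by (simp add: funpow_add comp_assoc)
    finally show ?thesis using adjoinI[OF s, of "h \<circ> h'" H] x y H by (auto simp: subgrp_def)
  qed
  ultimately show "subgrp (adjoin H s)" using sub HG by (auto simp: subgrp_def)
qed

lemma bij_betw_mult_mod_p:
  assumes "0 < k" "k < p"
  shows "bij_betw (\<lambda>i. (i * k) mod p) {..<p} {..<p}"
proof -
  have cop: "coprime k p" using assms p_prime by (metis coprime_commute nat_dvd_not_less prime_imp_coprime)
  have "inj_on (\<lambda>i. (i * k) mod p) {..<p}"
  proof (rule inj_onI)
    fix i l assume il: "i \<in> {..<p}" "l \<in> {..<p}" "(i * k) mod p = (l * k) mod p"
    then have "[i = l] (mod p)" using cong_mult_rcancel_nat[OF cop] by (simp add: cong_def)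
    then show "i = l" using il by (simp add: cong_def)
  qed
  moreover have "(\<lambda>i. (i * k) mod p) ` {..<p} \<subseteq> {..<p}" using p_gt_1 by auto
  ultimately show ?thesis by (simp add: bij_betw_def endo_inj_surj)
qed

text \<open>
  This replaces the decomposition of the group ring by characters. For a subgroup \<open>H\<close> of
  index at least \<open>p\<^sup>2\<close>, \<open>p\<close> times the sum over \<open>H\<close> is a combination of the sums over the overgroups in
  which \<open>H\<close> has index \<open>p\<close>; so a maximal proper subgroup with a nonvanishing coset sum has index \<open>p\<close>.
\<close>

lemma coset_sum_nonzero:
  fixes C :: "('n \<Rightarrow> 'n) \<Rightarrow> 'k"
  assumes "q > 1" "g\<^sub>0 \<in> G" "C g\<^sub>0 \<noteq> 0"
  obtains H g where "subgrp H" "H \<noteq> G" "\<And>s. s \<in> G \<Longrightarrow> s \<notin> H \<Longrightarrow> index_p H s"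
    "g \<in> G" "(\<Sum>h\<in>H. C (g \<circ> h)) \<noteq> 0"
proof -
  define S :: "('n \<Rightarrow> 'n) set \<Rightarrow> ('n \<Rightarrow> 'n) \<Rightarrow> 'k" where "S H g = (\<Sum>h\<in>H. C (g \<circ> h))" for H g
  define good where "good = {H. subgrp H \<and> H \<noteq> G \<and> (\<exists>g\<in>G. S H g \<noteq> 0)}"
  have "card {id :: 'n \<Rightarrow> 'n} \<noteq> card G" using card_G assms(1) by simp
  then have "{id} \<noteq> G" by metis
  then have "{id} \<in> good" using assms by (auto simp: good_def subgrp_def S_def)
  moreover have "good \<subseteq> Pow G" by (auto simp: good_def subgrp_def)
  then have "finite good" by (rule finite_subset) simp
  ultimately obtain H where Hg: "H \<in> good" and Hmax: "\<And>K. K \<in> good \<Longrightarrow> H \<subseteq> K \<Longrightarrow> H = K"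
    using finite_has_maximal[of good] by blast
  have H: "subgrp H" and HnG: "H \<noteq> G" using Hg by (auto simp: good_def)
  obtain g\<^sub>1 where g\<^sub>1: "g\<^sub>1 \<in> G" "S H g\<^sub>1 \<noteq> 0" using Hg by (auto simp: good_def)
  have S_adjoin: "S (adjoin H s) g = (\<Sum>i<p. S H (g \<circ> s ^^ i))" if "s \<in> G" "s \<notin> H" for s g
    unfolding S_def using that by (simp add: adjoin_sum[OF H] comp_assoc)
  have S_zero: "S (adjoin H s) g = 0" if "s \<in> G" "s \<notin> H" "adjoin H s \<noteq> G" "g \<in> G" for s g
  proof (rule ccontr)
    assume "S (adjoin H s) g \<noteq> 0"
    then have "adjoin H s \<in> good" using that adjoin[OF H that(1)] by (auto simp: good_def)
    then show False using Hmax[of "adjoin H s"] adjoin[OF H that(1)] that by auto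
  qed
  have "adjoin H s = G" if s: "s \<in> G" "s \<notin> H" for s
  proof (rule ccontr)
    assume A: "adjoin H s \<noteq> G"
    let ?A = "adjoin H s"
    have subA: "subgrp ?A" using adjoin[OF H s(1)] by simp
    \<comment> \<open>The groups \<open>adjoin H (s ^^ i \<circ> t)\<close> are proper as well and
      larger than \<open>H\<close>, so by maximality of \<open>H\<close> their coset sums vanish,
      like those of \<open>adjoin H s\<close>.\<close>
    then obtain t where t: "t \<in> G" "t \<notin> ?A" using A by (auto simp: subgrp_def)
    have compA: "x \<circ> y \<in> ?A" if "x \<in> ?A" "y \<in> ?A" for x y using subA that by (simp add: subgrp_def)
    have st: "s ^^ i \<circ> t \<in> G" for i using s t by (intro comp_G funpow_G)
    have stA: "s ^^ i \<circ> t \<notin> ?A" for i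
    proof
      assume "s ^^ i \<circ> t \<in> ?A"
      moreover have "(s ^^ i) ^^ (p - 1) \<in> ?A"
        using adjoin[OF H s(1)] subgrp_funpow[OF subA] by blast
      ultimately have "(s ^^ i) ^^ (p - 1) \<circ> (s ^^ i \<circ> t) \<in> ?A" using compA by blast
      then show False using t inverse_comp'[OF funpow_G[OF s(1)], of i t] by simp
    qed
    have stH: "s ^^ i \<circ> t \<notin> H" for i using stA adjoin(2)[OF H s(1)] by blast
    have ne: "adjoin H (s ^^ i \<circ> t) \<noteq> G" for i
    proof
      assume "adjoin H (s ^^ i \<circ> t) = G"
      then have "s \<in> adjoin H (s ^^ i \<circ> t)" using s by simp
      then obtain k h where kh: "k < p" "h \<in> H" "s = (s ^^ i \<circ> t) ^^ k \<circ> h" by (auto simp: adjoin_def)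
      have hG: "h \<in> G" using kh H by (auto simp: subgrp_def)
      have "k \<noteq> 0" using kh s by (intro notI) simp
      have "(s ^^ i \<circ> t) ^^ k = (s ^^ i \<circ> t) ^^ k \<circ> (h \<circ> (h ^^ (p - 1) \<circ> id))"
        using inverse_comp[OF hG, of id] by simp
      also have "\<dots> = ((s ^^ i \<circ> t) ^^ k \<circ> h) \<circ> h ^^ (p - 1)" by (simp add: comp_assoc)
      also have "\<dots> = s \<circ> h ^^ (p - 1)" using kh by simp
      also have "\<dots> \<in> ?A"
        using adjoin[OF H s(1)] subgrp_funpow[OF H kh(2)] by (intro compA) auto
      finally have "s ^^ i \<circ> t \<in> ?A"
        using subgrp_funpow_cancel[OF subA st, of k] kh \<open>k \<noteq> 0\<close> by auto
      then show False using stA by simp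
    qed
    have "S H g = 0" if g: "g \<in> G" for g
    proof -
      have tG: "g \<circ> t ^^ k \<in> G" for k using g t by (intro comp_G funpow_G)
      have pw: "g \<circ> (s ^^ i \<circ> t) ^^ k = (g \<circ> t ^^ k) \<circ> s ^^ (i * k)" for i k
      proof -
        have "(s ^^ i \<circ> t) ^^ k = t ^^ k \<circ> s ^^ (i * k)"
        proof (induction k)
          case (Suc k)
          have "(s ^^ i \<circ> t) ^^ Suc k = (s ^^ i \<circ> t) \<circ> (t ^^ k \<circ> s ^^ (i * k))" by (simp only: funpow.simps Suc)
          also have "\<dots> = s ^^ i \<circ> t ^^ Suc k \<circ> s ^^ (i * k)" by (simp add: comp_assoc)
          also have "s ^^ i \<circ> t ^^ Suc k = t ^^ Suc k \<circ> s ^^ i" using s t by (intro comm_G funpow_G)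
          also have "t ^^ Suc k \<circ> s ^^ i \<circ> s ^^ (i * k) = t ^^ Suc k \<circ> s ^^ (i * Suc k)"
            by (simp only: comp_assoc funpow_add[symmetric] mult_Suc_right)
          finally show ?case .
        qed simp
        then show ?thesis by (simp add: comp_assoc)
      qed
      \<comment> \<open>Summing over these \<open>p\<close> groups counts the coset of
        \<open>g\<close> once for each \<open>i\<close>, through the exponent
        \<open>k = 0\<close>.\<close>
      have "0 = (\<Sum>i<p. S (adjoin H (s ^^ i \<circ> t)) g)"
        using S_zero[OF st stH ne g] by simp
      also have "\<dots> = (\<Sum>i<p. \<Sum>k<p. S H ((g \<circ> t ^^ k) \<circ> s ^^ (i * k)))"
        by (simp only: S_adjoin[OF st stH] pw)
      also have "\<dots> = (\<Sum>k<p. \<Sum>i<p. S H ((g \<circ> t ^^ k) \<circ> s ^^ (i * k)))"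
        by (rule sum.swap)
      also have "\<dots> = (\<Sum>k<p. if k = 0 then of_nat p * S H g else 0)"
      proof (rule sum.cong[OF refl])
        fix k assume "k \<in> {..<p}"
        then have k: "k < p" by simp
        show "(\<Sum>i<p. S H ((g \<circ> t ^^ k) \<circ> s ^^ (i * k))) = (if k = 0 then of_nat p * S H g else 0)"
        proof (cases "k = 0")
          case False
          \<comment> \<open>For \<open>k \<noteq> 0\<close> the products \<open>i * k\<close> run
            through all residues modulo \<open>p\<close>, which yields a coset sum of
            \<open>adjoin H s\<close>.\<close>
          have "(\<Sum>i<p. S H ((g \<circ> t ^^ k) \<circ> s ^^ (i * k)))
              = (\<Sum>i<p. S H ((g \<circ> t ^^ k) \<circ> s ^^ ((i * k) mod p)))"
            by (simp only: funpow_mod_p[OF s(1)])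
          also have "\<dots> = (\<Sum>i<p. S H ((g \<circ> t ^^ k) \<circ> s ^^ i))"
            using sum.reindex_bij_betw[OF bij_betw_mult_mod_p, of k "\<lambda>i. S H ((g \<circ> t ^^ k) \<circ> s ^^ i)"]
              False k by simp
          also have "\<dots> = S ?A (g \<circ> t ^^ k)" by (simp only: S_adjoin[OF s])
          also have "\<dots> = 0" by (rule S_zero[OF s A tG])
          finally show ?thesis using False by simp
        qed simp
      qed
      also have "\<dots> = of_nat p * S H g" using p_gt_1 by (subst sum.delta) auto
      finally show "S H g = 0" using p_gt_1 by simp
    qed
    then show False using g\<^sub>1 by simp
  qed
  then have "index_p H s" if "s \<in> G" "s \<notin> H" for s using that H by (simp add: index_p_def)
  then show thesis using that[OF H HnG] g\<^sub>1 by (auto simp: S_def)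
qed

end

subsection \<open>Ramification breaks\<close>

context elementary_abelian_extension
begin

definition max_brk :: int where
  "max_brk = Max (brk ` (G - {id}))"

text \<open>The break of \<open>id\<close> is infinite; for sums of truncations at a break, \<open>max_brk\<close> is as good.\<close>

definition tbrk :: "('n \<Rightarrow> 'n) \<Rightarrow> int" where
  "tbrk g = (if g = id then max_brk else brk g)"

lemma brk_le_max: "g \<in> G \<Longrightarrow> g \<noteq> id \<Longrightarrow> brk g \<le> max_brk"
  unfolding max_brk_def by (intro Max_ge) auto

lemma max_brk_attained:
  assumes "q > 1"
  obtains g where "g \<in> G" "g \<noteq> id" "brk g = max_brk"
proof -
  have "card {id :: 'n \<Rightarrow> 'n} \<noteq> card G" using card_G assms by simp
  then have "G \<noteq> {id}" by metis
  then have "G - {id} \<noteq> {}" using id_G by auto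
  then have "max_brk \<in> brk ` (G - {id})" unfolding max_brk_def by (intro Max_in) auto
  then show thesis
  proof (rule imageE)
    fix g assume "max_brk = brk g" "g \<in> G - {id}"
    then show thesis using that[of g] by simp
  qed
qed

lemma tbrk_le_max: "g \<in> G \<Longrightarrow> tbrk g \<le> max_brk"
  by (simp add: tbrk_def brk_le_max)

lemma lower_ram_group_eq: "lower_ram_group f v \<pi> k = {g \<in> G. g = id \<or> k \<le> brk g}"
proof -
  have "g \<pi> - \<pi> = 0 \<longleftrightarrow> g = id" if "g \<in> G" for g using G_pi_eq[OF that] by auto
  then show ?thesis by (auto simp: lower_ram_group_def brk_def)
qed

lemma lower_breaks_eq: "lower_breaks f v \<pi> = brk ` (G - {id})"
proof
  show "lower_breaks f v \<pi> \<subseteq> brk ` (G - {id})"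
    by (force simp: lower_breaks_def lower_ram_group_eq)
  show "brk ` (G - {id}) \<subseteq> lower_breaks f v \<pi>"
  proof
    fix b assume "b \<in> brk ` (G - {id})"
    then obtain g where "g \<in> G" "g \<noteq> id" "b = brk g" by auto
    then show "b \<in> lower_breaks f v \<pi>"
      using brk_nonneg[of g] by (force simp: lower_breaks_def lower_ram_group_eq)
  qed
qed

text \<open>Herbrand's function counted by group elements instead of by breaks: passing to the next
  lower break adds the difference exactly to the summands of elements in the next ramification
  group.\<close>

lemma upper_break_eq:
  assumes i: "i < card (lower_breaks f v \<pi>)"
  shows "upper_break f v \<pi> i
    = of_int (\<Sum>g\<in>G. min (tbrk g) (sorted_list_of_set (lower_breaks f v \<pi>) ! i)) / of_nat q"
proof -
  let ?L = "lower_breaks f v \<pi>"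
  define bs where "bs = sorted_list_of_set ?L"
  define c where "c k = int (card (lower_ram_group f v \<pi> k))" for k
  have finL: "finite ?L" by (simp add: lower_breaks_eq)
  have len: "length bs = card ?L" and set_bs: "set bs = ?L" and srt: "sorted bs"
    using finL by (auto simp: bs_def)
  have "?L \<noteq> {}" using i by auto
  then have ne: "G - {id} \<noteq> {}" by (simp add: lower_breaks_eq)
  then have "max_brk \<in> ?L" unfolding max_brk_def lower_breaks_eq by (intro Max_in) auto
  then have tb: "tbrk g \<in> set bs" if "g \<in> G" for g
    using that by (auto simp: tbrk_def set_bs lower_breaks_eq)
  have bs_L: "bs ! k \<in> ?L" if "k < length bs" for k using that set_bs nth_mem by blast
  have c_eq: "c (bs ! k) = int (card {g\<in>G. bs ! k \<le> tbrk g})" if "k < length bs" for k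
  proof -
    have "b \<le> max_brk" if "b \<in> ?L" for b
      using that by (auto simp: lower_breaks_eq intro: brk_le_max)
    then have "bs ! k \<le> max_brk" using bs_L[OF that] by simp
    then have "{g \<in> G. g = id \<or> bs ! k \<le> brk g} = {g\<in>G. bs ! k \<le> tbrk g}"
      by (intro Collect_cong conj_cong refl) (simp add: tbrk_def)
    then show ?thesis by (simp add: c_def lower_ram_group_eq)
  qed
  have c0: "c (bs ! 0) = int q" and min0: "(\<Sum>g\<in>G. min (tbrk g) (bs ! 0)) = int q * bs ! 0"
  proof -
    have *: "bs ! 0 \<le> tbrk g" if g: "g \<in> G" for g
    proof -
      obtain k where "k < length bs" "bs ! k = tbrk g" using tb[OF g] by (auto simp: in_set_conv_nth)
      then show ?thesis using sorted_nth_mono[OF srt, of 0 k] by simp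
    qed
    then have "{g\<in>G. bs ! 0 \<le> tbrk g} = G" by auto
    then show "c (bs ! 0) = int q" using c_eq[of 0] i len card_G by force
    have "(\<Sum>g\<in>G. min (tbrk g) (bs ! 0)) = (\<Sum>g\<in>G. bs ! 0)"
      using * by (intro sum.cong) (auto intro: min_absorb2)
    then show "(\<Sum>g\<in>G. min (tbrk g) (bs ! 0)) = int q * bs ! 0" by (simp add: card_G)
  qed
  have main: "bs ! 0 * c (bs ! 0) + (\<Sum>j=1..k. (bs ! j - bs ! (j - 1)) * c (bs ! j))
      = (\<Sum>g\<in>G. min (tbrk g) (bs ! k))" if "k < length bs" for k
    using that
  proof (induction k)
    case 0
    then show ?case by (simp add: c0 min0)
  next
    case (Suc k)
    have le: "bs ! k \<le> bs ! Suc k" using Suc.prems by (intro sorted_nth_mono[OF srt]) auto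
    have "(\<Sum>g\<in>G. min (tbrk g) (bs ! Suc k))
        = (\<Sum>g\<in>G. min (tbrk g) (bs ! k) + (if bs ! Suc k \<le> tbrk g then bs ! Suc k - bs ! k else 0))"
    proof (rule sum.cong[OF refl])
      fix g assume g: "g \<in> G"
      obtain l where l: "l < length bs" "bs ! l = tbrk g" using tb[OF g] by (auto simp: in_set_conv_nth)
      \<comment> \<open>No break lies strictly between two consecutive entries of
        \<open>bs\<close>.\<close>
      have "tbrk g \<le> bs ! k \<or> bs ! Suc k \<le> tbrk g"
      proof (cases "l \<le> k")
        case True
        then show ?thesis using sorted_nth_mono[OF srt True] Suc.prems l by auto
      next
        case False
        then show ?thesis using sorted_nth_mono[OF srt, of "Suc k" l] l by auto
      qed
      then show "min (tbrk g) (bs ! Suc k)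
          = min (tbrk g) (bs ! k) + (if bs ! Suc k \<le> tbrk g then bs ! Suc k - bs ! k else 0)"
        using le by auto
    qed
    also have "\<dots> = (\<Sum>g\<in>G. min (tbrk g) (bs ! k)) + (bs ! Suc k - bs ! k) * c (bs ! Suc k)"
      using c_eq[OF Suc.prems] by (simp add: sum.distrib sum.inter_filter[symmetric])
    also have "(\<Sum>g\<in>G. min (tbrk g) (bs ! k))
        = bs ! 0 * c (bs ! 0) + (\<Sum>j=1..k. (bs ! j - bs ! (j - 1)) * c (bs ! j))"
      using Suc by simp
    finally show ?case by simp
  qed
  show ?thesis
  proof (cases "i = 0")
    case True
    then show ?thesis
      using min0 q_pos by (simp add: upper_break_def Let_def bs_def[symmetric])
  next
    case False
    then have "upper_break f v \<pi> i
        = of_int (bs ! 0 * c (bs ! 0) + (\<Sum>j=1..i. (bs ! j - bs ! (j - 1)) * c (bs ! j))) / of_nat q"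
      by (simp only: upper_break_def Let_def bs_def c_def degree if_False)
    then show ?thesis using main[of i] i len by (simp only: bs_def[symmetric])
  qed
qed

lemma upper_breaks_coprime:
  assumes upper: "\<forall>u \<in> upper_breaks f v \<pi>. \<exists>m::int. u = of_int m \<and> coprime m (int p)"
    and g: "g \<in> G" "g \<noteq> id"
  obtains m where "coprime m (int p)" "(\<Sum>h\<in>G. min (tbrk h) (brk g)) = int q * m"
proof -
  let ?L = "lower_breaks f v \<pi>"
  have finL: "finite ?L" by (simp add: lower_breaks_eq)
  have "brk g \<in> set (sorted_list_of_set ?L)" using g finL by (auto simp: lower_breaks_eq)
  then obtain i where i: "i < card ?L" "sorted_list_of_set ?L ! i = brk g"
    unfolding in_set_conv_nth length_sorted_list_of_set by blast
  then obtain m where m: "upper_break f v \<pi> i = of_int m" "coprime m (int p)"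
    using upper by (auto simp: upper_breaks_def)
  then have "of_int (\<Sum>h\<in>G. min (tbrk h) (brk g)) = (of_int (int q * m) :: rat)"
    using upper_break_eq[OF i(1)] i(2) q_pos by (simp add: field_simps)
  then have "(\<Sum>h\<in>G. min (tbrk h) (brk g)) = int q * m" by (simp only: of_int_eq_iff)
  then show thesis using that m by blast
qed

text \<open>A lower break 0 makes all truncated summands 0, so the corresponding upper break is 0,
  which is not prime to \<open>p\<close>.\<close>

lemma brk_pos:
  assumes upper: "\<forall>u \<in> upper_breaks f v \<pi>. \<exists>m::int. u = of_int m \<and> coprime m (int p)"
    and g: "g \<in> G" "g \<noteq> id"
  shows "brk g > 0"
proof (rule ccontr)
  assume "\<not> brk g > 0"
  then have b0: "brk g = 0" using brk_nonneg[OF g] by simp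
  have "max_brk \<ge> 0" using brk_le_max[OF g] b0 by simp
  then have "min (tbrk h) 0 = 0" if "h \<in> G" for h
    using brk_nonneg[OF that] by (auto simp: tbrk_def)
  then have "(\<Sum>h\<in>G. min (tbrk h) (brk g)) = 0" using b0 by simp
  moreover obtain m where m: "coprime m (int p)" "(\<Sum>h\<in>G. min (tbrk h) (brk g)) = int q * m"
    using upper_breaks_coprime[OF upper g] by blast
  ultimately have "m = 0" using q_pos by simp
  then show False using m p_gt_1 by simp
qed

text \<open>As \<open>brk s\<close> is maximal outside \<open>H\<close>, each
  \<open>s ^^ i \<circ> h\<close> with \<open>0 < i < p\<close> has break
  \<open>min (tbrk h) (brk s)\<close>. So the sum over \<open>G\<close> truncated at
  \<open>brk s\<close> is \<open>p\<close> times that over \<open>H\<close>, and \<open>u\<close> is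
  the upper break belonging to \<open>brk s\<close>. Comparison with the sum truncated at
  \<open>max_brk\<close> gives the last identity.\<close>

lemma index_p_breaks:
  assumes upper: "\<forall>u \<in> upper_breaks f v \<pi>. \<exists>m::int. u = of_int m \<and> coprime m (int p)"
    and Hs: "index_p H s"
    and max: "\<And>g. g \<in> G \<Longrightarrow> g \<notin> H \<Longrightarrow> brk g \<le> brk s"
  obtains u k where "(\<Sum>h\<in>H. brk (s \<circ> h)) = int (card H) * u" "u > 0" "coprime u (int p)"
    "max_brk + (\<Sum>h\<in>H - {id}. brk h) = int (card H) * (u + int p * k)"
proof -
  let ?t = "brk s" and ?d = "int (card H)"
  have H: "subgrp H" and s: "s \<in> G" "s \<notin> H" and HG: "H \<subseteq> G" and idH: "id \<in> H"
    using Hs by (auto simp: index_p_def subgrp_def)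
  have q: "int q = int p * ?d" using index_p_card[OF Hs] by simp
  have d: "?d > 0" using card_subgrp_pos[OF H] by simp
  have sid: "s \<noteq> id" using s idH by auto
  have bi: "s ^^ i \<circ> h \<notin> H \<and> brk (s ^^ i \<circ> h) = min (tbrk h) ?t" if i: "0 < i" "i < p" and h: "h \<in> H" for i h
  proof -
    let ?g = "s ^^ i \<circ> h"
    have hG: "h \<in> G" using h HG by auto
    have siG: "s ^^ k \<in> G" for k by (rule funpow_G[OF s(1)])
    have siH: "s ^^ i \<notin> H" using subgrp_funpow_cancel[OF H s(1) i] s by blast
    have gH: "?g \<notin> H"
    proof
      assume "?g \<in> H"
      then have "?g \<circ> h ^^ (p - 1) \<in> H" using H subgrp_funpow[OF H h] by (auto simp: subgrp_def)
      moreover have "?g \<circ> h ^^ (p - 1) = s ^^ i"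
        using inverse_comp[OF hG, of id] by (simp add: comp_assoc)
      ultimately show False using siH by simp
    qed
    have gG: "?g \<in> G" using siG hG comp_G by blast
    have gid: "?g \<noteq> id" using gH idH by auto
    have pow: "s ^^ k = id \<or> ?t \<le> brk (s ^^ k)" for k by (rule brk_funpow[OF s(1)]) simp
    have "s ^^ i = id \<or> min (tbrk h) ?t \<le> brk (s ^^ i)" using pow[of i] by auto
    moreover have "h = id \<or> min (tbrk h) ?t \<le> brk h" by (auto simp: tbrk_def)
    ultimately have ge: "min (tbrk h) ?t \<le> brk ?g"
      using brk_comp[OF siG[of i] hG] gid by blast
    have le: "brk ?g \<le> ?t" using max gG gH by blast
    have "brk ?g \<le> tbrk h"
    proof (cases "h = id")
      case True
      then show ?thesis using brk_le_max[OF gG gid] by (simp add: tbrk_def)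
    next
      case False
      show ?thesis
      proof (rule ccontr)
        assume "\<not> ?thesis"
        then have lt: "brk h < brk ?g" using False by (simp add: tbrk_def)
        \<comment> \<open>This writes \<open>h\<close> as a product of two elements whose breaks are
          at least \<open>brk ?g\<close>.\<close>
        have "s ^^ (p - i) \<circ> ?g = s ^^ (p - i + i) \<circ> h" by (simp only: funpow_add comp_assoc)
        then have "s ^^ (p - i) \<circ> ?g = h" using i funpow_p[OF s(1)] by simp
        then have "h = id \<or> brk ?g \<le> brk h"
          using brk_comp[OF siG[of "p - i"] gG, of "brk ?g"] pow[of "p - i"] le by auto
        then show False using lt False by simp
      qed
    qed
    then show ?thesis using ge le gH by auto
  qed
  have sum1: "(\<Sum>h\<in>H. brk (s \<circ> h)) = (\<Sum>h\<in>H. min (tbrk h) ?t)"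
    using bi[of 1] p_gt_1 by (intro sum.cong) auto
  obtain u where u: "coprime u (int p)" "(\<Sum>g\<in>G. min (tbrk g) ?t) = int q * u"
    using upper_breaks_coprime[OF upper s(1) sid] by blast
  have "(\<Sum>g\<in>G. min (tbrk g) ?t) = (\<Sum>i<p. \<Sum>h\<in>H. min (tbrk h) ?t)"
    unfolding index_p_sum[OF Hs]
  proof (intro sum.cong refl)
    fix i h assume i: "i \<in> {..<p}" and h: "h \<in> H"
    show "min (tbrk (s ^^ i \<circ> h)) ?t = min (tbrk h) ?t"
    proof (cases "i = 0")
      case False
      then have "s ^^ i \<circ> h \<notin> H" "brk (s ^^ i \<circ> h) = min (tbrk h) ?t" using bi[of i h] i h by auto
      moreover have "s ^^ i \<circ> h \<noteq> id" using calculation idH by metis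
      ultimately show ?thesis by (simp add: tbrk_def)
    qed simp
  qed
  also have "\<dots> = int p * (\<Sum>h\<in>H. min (tbrk h) ?t)" by simp
  finally have "int p * (\<Sum>h\<in>H. min (tbrk h) ?t) = int p * (?d * u)" using u(2) q by (metis mult.assoc)
  then have sumH: "(\<Sum>h\<in>H. min (tbrk h) ?t) = ?d * u" using p_gt_1 by simp
  have "(\<Sum>h\<in>H. min (tbrk h) ?t) > 0"
  proof (rule sum_pos)
    have "max_brk > 0" using brk_le_max[OF s(1) sid] brk_pos[OF upper s(1) sid] by simp
    then show "min (tbrk h) ?t > 0" if "h \<in> H" for h
      using that HG brk_pos[OF upper] s(1) sid by (auto simp: tbrk_def)
  qed (use idH finite_subgrp[OF H] in auto)
  then have u0: "u > 0" using sumH d by (simp add: zero_less_mult_iff)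
  have "p * 1 \<le> p * card H" using d by (intro mult_le_mono) auto
  then have "q > 1" using index_p_card[OF Hs] p_gt_1 by linarith
  then obtain g where g: "g \<in> G" "g \<noteq> id" "brk g = max_brk" by (rule max_brk_attained)
  obtain m where m: "(\<Sum>h\<in>G. min (tbrk h) max_brk) = int q * m"
    using upper_breaks_coprime[OF upper g(1,2)] g(3) by metis
  have "(\<Sum>h\<in>G. min (tbrk h) max_brk) = (\<Sum>h\<in>G. tbrk h)"
    using tbrk_le_max by (intro sum.cong) (auto simp: min_def)
  then have "int q * m - int q * u = (\<Sum>g\<in>G. tbrk g - min (tbrk g) ?t)"
    using m u(2) by (simp add: sum_subtractf)
  \<comment> \<open>Outside \<open>H\<close> no break exceeds \<open>?t\<close>, so truncation
    changes nothing there.\<close>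
  also have "\<dots> = (\<Sum>h\<in>H. tbrk h - min (tbrk h) ?t)"
    by (rule sum.mono_neutral_right) (use max idH HG in \<open>auto simp: tbrk_def\<close>)
  also have "\<dots> = (\<Sum>h\<in>H. tbrk h) - ?d * u" by (simp add: sum_subtractf sumH)
  also have "(\<Sum>h\<in>H. tbrk h) = max_brk + (\<Sum>h\<in>H - {id}. brk h)"
    using idH finite_subgrp[OF H] by (subst sum.remove[of _ id]) (auto simp: tbrk_def)
  finally have "max_brk + (\<Sum>h\<in>H - {id}. brk h) = ?d * (u + int p * (m - u))"
    using q by (simp add: algebra_simps)
  then show thesis using that[of u "m - u"] sum1 sumH u0 u(1) by simp
qed

text \<open>Truncation at the largest break is void, so the sum of all \<open>tbrk\<close> is
  \<open>q\<close> times the upper break belonging to \<open>max_brk\<close>, an integer.\<close>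

lemma dvd_max_brk_sum:
  assumes upper: "\<forall>u \<in> upper_breaks f v \<pi>. \<exists>m::int. u = of_int m \<and> coprime m (int p)"
    and "q > 1"
  shows "int q dvd max_brk + (\<Sum>g\<in>G - {id}. brk g)"
proof -
  obtain g where g: "g \<in> G" "g \<noteq> id" "brk g = max_brk" using assms(2) by (rule max_brk_attained)
  obtain m where m: "(\<Sum>h\<in>G. min (tbrk h) max_brk) = int q * m"
    using upper_breaks_coprime[OF upper g(1,2)] g(3) by metis
  have "(\<Sum>h\<in>G. min (tbrk h) max_brk) = (\<Sum>h\<in>G. tbrk h)"
    using tbrk_le_max by (intro sum.cong) (auto simp: min_def)
  also have "\<dots> = max_brk + (\<Sum>h\<in>G - {id}. brk h)"
    by (subst sum.remove[of _ id]) (auto simp: tbrk_def)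
  finally show ?thesis using m by (metis dvd_triv_left)
qed

subsection \<open>The valuation criterion\<close>

lemma normal_basis_valuation:
  assumes upper: "\<forall>u \<in> upper_breaks f v \<pi>. \<exists>m::int. u = of_int m \<and> coprime m (int p)"
    and q: "q > 1" and a: "a \<noteq> 0" "[v a = max_brk] (mod int q)"
  shows "generates_normal_basis f a"
proof -
  have indep: "\<forall>g\<in>G. C g = 0" if zero: "(\<Sum>g\<in>G. f (C g) * g a) = 0" for C
  proof (rule ccontr)
    assume "\<not> ?thesis"
    then obtain g\<^sub>0 where "g\<^sub>0 \<in> G" "C g\<^sub>0 \<noteq> 0" by auto
    \<comment> \<open>A nontrivial relation has a nonzero coset sum for some \<open>H\<close> of
      index \<open>p\<close>. Below it becomes a coefficient \<open>D i\<close> of a relation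
      between the conjugates of the trace \<open>?b\<close>.\<close>
    then obtain H g where H: "subgrp H" "H \<noteq> G" and ind: "\<And>s. s \<in> G \<Longrightarrow> s \<notin> H \<Longrightarrow> index_p H s"
      and g: "g \<in> G" "(\<Sum>h\<in>H. C (g \<circ> h)) \<noteq> 0"
      using coset_sum_nonzero[OF q, of g\<^sub>0 C] by metis
    have HG: "H \<subseteq> G" and idH: "id \<in> H" using H by (auto simp: subgrp_def)
    have ne: "brk ` (G - H) \<noteq> {}" using H HG by auto
    have "Max (brk ` (G - H)) \<in> brk ` (G - H)" using ne by (intro Max_in) auto
    then obtain s where s: "s \<in> G" "s \<notin> H" "brk s = Max (brk ` (G - H))" by auto
    have max: "brk g \<le> brk s" if "g \<in> G" "g \<notin> H" for g
      unfolding s(3) using that by (intro Max_ge) auto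
    have Hs: "index_p H s" using ind s by blast
    let ?d = "int (card H)" and ?b = "tr H a"
    obtain u k where u: "(\<Sum>h\<in>H. brk (s \<circ> h)) = ?d * u" "u > 0" "coprime u (int p)"
      "max_brk + (\<Sum>h\<in>H - {id}. brk h) = ?d * (u + int p * k)"
      using index_p_breaks[OF upper Hs max] by blast
    obtain l where l: "v a = max_brk + int q * l"
      using a(2) by (metis cong_iff_lin cong_sym)
    have qpd: "int q = int p * ?d" using index_p_card[OF Hs] by simp
    have va: "v a + (\<Sum>h\<in>H - {id}. brk h) = ?d * (u + int p * (k + l))"
      using u(4) l qpd by (simp add: algebra_simps)
    have b: "?b \<noteq> 0" "v ?b = ?d * (u + int p * (k + l))"
      using v_tr[OF H(1) a(1)] va by auto
    have bfix: "\<forall>h\<in>H. h ?b = ?b" using tr_fixed[OF H(1)] by blast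
    define D where "D i = (\<Sum>h\<in>H. C (s ^^ i \<circ> h))" for i
    have "0 = tr H (\<Sum>g\<in>G. f (C g) * g a)"
      unfolding zero tr_def by (rule sum.neutral[symmetric]) (use HG emb_zero[OF G_emb] in blast)
    also have "\<dots> = (\<Sum>g\<in>G. f (C g) * tr H (g a))"
      unfolding tr_sum[OF H(1)]
      by (intro sum.cong refl tr_mult[OF H(1)]) (use HG G_base in blast)
    also have "\<dots> = (\<Sum>g\<in>G. f (C g) * g ?b)"
    proof (intro sum.cong refl)
      fix g assume g: "g \<in> G"
      have "tr H (g a) = g ?b"
        unfolding tr_def emb_sum[OF G_emb[OF g]] using HG comm_G'[OF _ g] by (intro sum.cong) auto
      then show "f (C g) * tr H (g a) = f (C g) * g ?b" by simp
    qed
    also have "\<dots> = (\<Sum>i<p. \<Sum>h\<in>H. f (C (s ^^ i \<circ> h)) * (s ^^ i) ?b)"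
      unfolding index_p_sum[OF Hs]
    proof (intro sum.cong refl)
      fix i h assume "h \<in> H"
      then have "h ?b = ?b" using bfix by blast
      then show "f (C (s ^^ i \<circ> h)) * (s ^^ i \<circ> h) ?b = f (C (s ^^ i \<circ> h)) * (s ^^ i) ?b" by simp
    qed
    also have "\<dots> = (\<Sum>i<p. f (D i) * (s ^^ i) ?b)"
      by (simp add: D_def f_hom sum_distrib_right)
    finally have "(\<Sum>i<p. f (D i) * (s ^^ i) ?b) = 0" by simp
    then have D0: "\<forall>i<p. D i = 0"
      using conjugates_independent[OF Hs b(1) bfix u(1-3) b(2)] by (simp add: cong_def)
    have "g \<in> adjoin H s" using g Hs by (simp add: index_p_def)
    then obtain i h where ih: "i < p" "h \<in> H" "g = s ^^ i \<circ> h" by (auto simp: adjoin_def)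
    have "(\<Sum>t\<in>H. C (g \<circ> t)) = D i"
      using sum_translate[OF H(1) ih(2), of "\<lambda>t. C (s ^^ i \<circ> t)"] by (simp add: ih(3) D_def comp_assoc)
    then show False using g D0 ih by simp
  qed
  have "card G = ext_degree f" by (simp add: card_G degree)
  then show ?thesis
    unfolding generates_normal_basis_def
    by (intro conjI independent_family_basis(1,2)[OF ext finite_G] indep)
qed

text \<open>The vanishing trace is a relation between the conjugates. As conjugates may coincide,
  the set of conjugates carries the multiplicities \<open>u y\<close>, which are nonzero in
  characteristic 0.\<close>

lemma tr_zero_not_normal_basis:
  assumes "tr G x = 0"
  shows "\<not> generates_normal_basis f x"
proof -
  interpret vs: vector_space "ext_scale f" by (rule vector_space_ext_scale[OF emb_f])
  let ?S = "(\<lambda>g. g x) ` G"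
  define u where "u y = (of_nat (card {g\<in>G. g x = y}) :: 'k)" for y
  have "(\<Sum>y\<in>?S. ext_scale f (u y) y) = (\<Sum>y\<in>?S. \<Sum>g\<in>{g\<in>G. g x = y}. g x)"
    by (intro sum.cong refl) (simp add: ext_scale_def u_def f_hom)
  also have "\<dots> = tr G x"
    unfolding tr_def by (rule sum.image_gen[symmetric]) simp
  finally have "(\<Sum>y\<in>?S. ext_scale f (u y) y) = 0" using assms by simp
  moreover have "\<exists>y\<in>?S. u y \<noteq> 0"
    by (intro bexI[of _ x] image_eqI[of _ _ id]) (auto simp: u_def card_eq_0_iff intro: exI[of _ id])
  ultimately have "vs.dependent ?S" using vs.dependent_finite[of ?S] by auto
  then show ?thesis by (simp add: generates_normal_basis_def)
qed

text \<open>By Euler's formula \<open>\<pi> ^ i / dif G\<close> has trace 0 for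
  \<open>i < q - 1\<close>. Base multiples of these elements reach every residue class modulo
  \<open>q\<close> except the one for \<open>i = q - 1\<close>, which is that of
  \<open>max_brk\<close>.\<close>

lemma not_normal_basis_valuation:
  assumes upper: "\<forall>u \<in> upper_breaks f v \<pi>. \<exists>m::int. u = of_int m \<and> coprime m (int p)"
    and q: "q > 1" and w: "\<not> [w = max_brk] (mod int q)"
  shows "\<exists>x. x \<noteq> 0 \<and> v x = w \<and> \<not> generates_normal_basis f x"
proof -
  define i where "i = nat ((w + v (dif G)) mod int q)"
  have i: "int i = (w + v (dif G)) mod int q" using q_pos by (simp add: i_def)
  have "i < q" using i q_pos by (metis of_nat_0_less_iff of_nat_less_iff pos_mod_bound)
  obtain m where m: "max_brk + (\<Sum>g\<in>G - {id}. brk g) = int q * m"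
    using dvd_max_brk_sum[OF upper q] by (auto elim: dvdE)
  have vd: "v (dif G) = int q * m - max_brk + int q - 1"
    using v_dif[OF subgrp_G] m card_G by simp
  have dvd_i: "int q dvd w + v (dif G) - int i" unfolding i by (simp add: minus_mod_eq_mult_div)
  have "i \<noteq> q - 1"
  proof
    assume "i = q - 1"
    then have "w + v (dif G) - int i = (w - max_brk) + int q * m" using vd q by (simp add: of_nat_diff)
    then have "int q dvd w - max_brk" using dvd_i by (metis dvd_add_left_iff dvd_triv_left)
    then show False using w by (simp add: cong_iff_dvd_diff)
  qed
  then have "Suc i < card ((\<lambda>g. g \<pi>) ` G)"
    using \<open>i < q\<close> card_pi_image[OF subgrp_G] card_G by simp
  then have tr0: "tr G (\<pi> ^ i / dif G) = 0"
    unfolding tr_pi_power[OF subgrp_G] by (intro lagrange_sum_lt) auto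
  obtain c where c: "c \<noteq> 0" "v (f c) = w + v (dif G) - int i" using v_base_surj[OF dvd_i] by blast
  let ?x = "f c * (\<pi> ^ i / dif G)"
  have "?x \<noteq> 0" using c pi_nonzero dif_nonzero[OF subgrp_G] by (simp add: f_hom)
  moreover have "v ?x = w"
    using c pi_nonzero dif_nonzero[OF subgrp_G] v_mult[of "f c" "\<pi> ^ i / dif G"]
    by (simp add: f_hom v_divide v_power v_pi)
  moreover have "tr G ?x = f c * tr G (\<pi> ^ i / dif G)"
    by (rule tr_mult[OF subgrp_G]) (use G_base in blast)
  then have "tr G ?x = 0" by (simp only: tr0 mult_zero_right)
  ultimately show ?thesis using tr_zero_not_normal_basis by blast
qed

end

section \<open>The p-adic setting and the theorem\<close>

lemma v_residue_char_pos:
  fixes v :: "'n::field_char_0 \<Rightarrow> int"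
  assumes p: "prime p" and a: "is_padic_field p a" and j: "field_embedding j"
    and v: "normalized_valuation p a j v"
  shows "v (of_nat p) > 0"
proof -
  obtain e where e: "e > 0" "\<And>x. x \<noteq> 0 \<Longrightarrow> a x = real p powr (- real_of_int (v (j x)) / e)"
    using v by (auto simp: normalized_valuation_def)
  have p1: "real p > 1" using prime_gt_1_nat[OF p] by simp
  have "multiplicity (int p) (int p) = 1"
    using p by (intro multiplicity_self) auto
  then have "padic_abs p (of_nat p) = inverse (real p)"
    using p1 by (simp add: padic_abs_def power_int_def)
  moreover have "a (of_rat (of_nat p)) = padic_abs p (of_nat p)" using a unfolding is_padic_field_def by blast
  ultimately have "a (of_nat p) < 1" using p1 by (simp add: inverse_less_1_iff)
  then have "real p powr (- real_of_int (v (j (of_nat p))) / e) < real p powr 0"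
    using e(2)[of "of_nat p"] p1 by simp
  then have "- real_of_int (v (j (of_nat p))) / e < 0" using p1 by (simp only: powr_less_cancel_iff)
  then show ?thesis using e(1) by (simp add: emb_of_nat[OF j] zero_less_divide_iff divide_less_0_iff)
qed

theorem theorem1:
  fixes p n :: nat
    and absQ :: "'q::field_char_0 \<Rightarrow> real"
    and j :: "'q \<Rightarrow> 'k::field_char_0"
    and f :: "'k \<Rightarrow> 'n::field_char_0"
    and v :: "'n \<Rightarrow> int"
    and \<pi> :: 'n
  assumes "prime p"
    and "is_padic_field p absQ"
    and "finite_extension j"
    and "galois_extension f"
    and "normalized_valuation p absQ (f \<circ> j) v"
    and "prime_element v \<pi>"
    and "totally_ramified f v"
    and "elementary_abelian p (galois_group f)"
    and "card (galois_group f) = p ^ n"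
    and "ext_degree f = p ^ n"
    and "\<forall>u \<in> upper_breaks f v \<pi>. \<exists>m::int. u = of_int m \<and> coprime m (int p)"
  defines "b_max \<equiv> Max (lower_breaks f v \<pi>)"
  shows "(\<forall>\<alpha>. \<alpha> \<noteq> 0 \<and> [v \<alpha> = b_max] (mod int (ext_degree f)) \<longrightarrow>
              generates_normal_basis f \<alpha>)
       \<and> (\<forall>w::int. \<not> [w = b_max] (mod int (ext_degree f)) \<longrightarrow>
              (\<exists>\<rho>. \<rho> \<noteq> 0 \<and> v \<rho> = w \<and> \<not> generates_normal_basis f \<rho>))"
proof -
  have emb: "field_embedding (f \<circ> j)"
    using assms(3,4) by (auto simp: galois_extension_def finite_extension_def field_embedding_def)
  interpret elementary_abelian_extension v f \<pi> "p ^ n" p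
  proof unfold_locales
    show "\<And>x y. x \<noteq> 0 \<Longrightarrow> y \<noteq> 0 \<Longrightarrow> v (x * y) = v x + v y"
      and "\<And>x y. x \<noteq> 0 \<Longrightarrow> y \<noteq> 0 \<Longrightarrow> x + y \<noteq> 0 \<Longrightarrow> min (v x) (v y) \<le> v (x + y)"
      using assms(5) by (auto simp: normalized_valuation_def)
    show "v ` (range f - {0}) = {m. int (p ^ n) dvd m}"
      using assms(7,10) by (simp add: totally_ramified_def)
    show "v (of_nat p) > 0" by (rule v_residue_char_pos[OF assms(1,2) emb assms(5)])
  qed (use assms prime_gt_0_nat in \<open>auto simp: galois_extension_def prime_element_def\<close>)
  show ?thesis
  proof (cases "n = 0")
    \<comment> \<open>In degree 1 there are no lower breaks and \<open>b_max\<close> is the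
      \<open>Max\<close> of the empty set, but all integers are congruent modulo 1: the first claim
      concerns every nonzero element and the second is vacuous.\<close>
    case True
    then have G: "G = {id}" using assms(9) id_G by (metis card_1_singletonE power_0 singletonD)
    have "generates_normal_basis f \<alpha>" if "\<alpha> \<noteq> 0" for \<alpha>
      unfolding generates_normal_basis_def G
      by (intro conjI independent_family_basis(1,2)[OF ext]) (use that True degree in \<open>auto simp: f_hom\<close>)
    then show ?thesis using True assms(10) by simp
  next
    case False
    then have "p ^ n > 1" using p_gt_1 by (intro one_less_power) auto
    moreover have "b_max = max_brk" by (simp add: b_max_def lower_breaks_eq max_brk_def)
    ultimately show ?thesis
      using normal_basis_valuation[OF assms(11)] not_normal_basis_valuation[OF assms(11)]
      unfolding assms(10) by blast
  qed
qed

end
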